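(* $I^*$ is a non-trivial Borel $\sigma$-ideal on $\mathbf{Tr}$ which does not satisfy ccc but satisfies the $\omega_2$-chain condition: there is no family of $\omega_2$ Borel sets not in $I^*$ whose pairwise intersections all belong to $I^*$.
   Context: $\mathbf{Tr}$ is the set of all subtrees of $\omega^{<\omega}$ (subsets closed under initial segments), a closed subspace of $2^{(\omega^{<\omega})}$ with the product topology. $\mathbf{Trw}\subseteq\mathbf{Tr}$ is the set of well-founded trees. For $T\in\mathbf{Trw}$, $h_T:T\to\omega_1$ is the canonical rank function: $h_T(\nu)=\sup\{h_T(\nu')+1:\nu'\in T \text{ an immediate successor of }\nu\}$. For $\alpha<\omega_1$, $A_\alpha=\{T\in\mathbf{Trw}: h_T(\langle\rangle)=\alpha\}$. For $n\in\omega$ let $n^{\le n}$ be the set of sequences of length $\le n$ with values $<n$. $\tau_\alpha$ is the topology on $A_\alpha$ with basis the sets $U(n,T)=\{T'\in A_\alpha: T'\cap n^{\le n}=T\cap n^{\le n} \text{ and } h_{T'}\restriction (T\cap n^{\le n})=h_T\restriction(T\cap n^{\le n})\}$ for $T\in A_\alpha$, $n\in\omega$. $I^*$ is the family of all subsets of Borel sets $B\subseteq\mathbf{Tr}$ such that $B\cap A_\alpha$ is $\tau_\alpha$-meager for every $0<\alpha<\omega_1$. An ideal satisfies ccc if every family of pairwise disjoint Borel sets not in the ideal is countable. *)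

theory Defs
  imports "HOL-Analysis.Analysis"
begin

text \<open>Sequences in omega^{<omega} are lists of naturals; a tree is a set of such
lists closed under initial segments.\<close>

definition Tr :: "nat list set set" where
  "Tr = {T. \<forall>s\<in>T. \<forall>n. take n s \<in> T}"

definition Trw :: "nat list set set" where
  "Trw = {T \<in> Tr. \<not> (\<exists>x::nat \<Rightarrow> nat. \<forall>n. map x [0..<n] \<in> T)}"

text \<open>omega_1 is represented by the well-order W = cardSuc natLeq, a cardinal order
of cardinality aleph_1, hence of order type omega_1: the countable ordinals are
the elements of Field W, ordered by W.\<close>

abbreviation W :: "(nat set \<times> nat set) set" where
  "W \<equiv> cardSuc natLeq"

definition ord_zero :: "nat set" where
  "ord_zero = wo_rel.minim W (Field W)"

definition ord_succ :: "nat set \<Rightarrow> nat set" where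
  "ord_succ a = wo_rel.suc W {a}"

definition ord_sup :: "nat set set \<Rightarrow> nat set" where
  "ord_sup A = wo_rel.supr W A"

definition rank_fun :: "nat list set \<Rightarrow> nat list \<Rightarrow> nat set" where
  "rank_fun T = (THE f. (\<forall>\<nu>\<in>T. f \<nu> \<in> Field W \<and>
       f \<nu> = ord_sup {ord_succ (f (\<nu> @ [k])) | k. \<nu> @ [k] \<in> T})
     \<and> (\<forall>\<nu>. \<nu> \<notin> T \<longrightarrow> f \<nu> = undefined))"

definition A :: "nat set \<Rightarrow> nat list set set" where
  "A \<alpha> = {T \<in> Trw. [] \<in> T \<and> rank_fun T [] = \<alpha>}"

definition box :: "nat \<Rightarrow> nat list set" where
  "box n = {s. length s \<le> n \<and> (\<forall>x\<in>set s. x < n)}"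

definition U :: "nat set \<Rightarrow> nat \<Rightarrow> nat list set \<Rightarrow> nat list set set" where
  "U \<alpha> n T = {T' \<in> A \<alpha>. T' \<inter> box n = T \<inter> box n \<and>
       (\<forall>\<nu>\<in>T \<inter> box n. rank_fun T' \<nu> = rank_fun T \<nu>)}"

definition tau :: "nat set \<Rightarrow> nat list set topology" where
  "tau \<alpha> = topology_generated_by {U \<alpha> n T | n T. T \<in> A \<alpha>}"

definition nowhere_dense_in :: "'a topology \<Rightarrow> 'a set \<Rightarrow> bool" where
  "nowhere_dense_in X S \<longleftrightarrow> S \<subseteq> topspace X \<and> X interior_of (X closure_of S) = {}"

definition meager_in :: "'a topology \<Rightarrow> 'a set \<Rightarrow> bool" where
  "meager_in X S \<longleftrightarrow> (\<exists>F. countable F \<and> (\<forall>N\<in>F. nowhere_dense_in X N) \<and> S \<subseteq> \<Union>F)"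

text \<open>Tr is a closed subspace of 2^(omega^{<omega}) (identified with
nat list => bool, product of discrete spaces). Borel subsets of Tr are those
whose image under the characteristic-function map is Borel.\<close>

definition Borel_Tr :: "nat list set set \<Rightarrow> bool" where
  "Borel_Tr B \<longleftrightarrow> B \<subseteq> Tr \<and>
     (\<lambda>T s. s \<in> T) ` B \<in> sets (borel :: (nat list \<Rightarrow> bool) measure)"

definition Istar :: "nat list set set set" where
  "Istar = {S. \<exists>B. Borel_Tr B \<and> S \<subseteq> B \<and>
      (\<forall>\<alpha>\<in>Field W. \<alpha> \<noteq> ord_zero \<longrightarrow> meager_in (tau \<alpha>) (B \<inter> A \<alpha>))}"

end

(* For 0 < alpha < omega_1 the sets A alpha are pairwise disjoint and Borel: "the subtree at nu is
   well-founded of rank at most beta" is defined by a countable recursion on beta. Each space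
   (A alpha, tau alpha) is a Baire space. Given countably many nowhere dense sets, a fusion argument
   builds trees that agree, ranks included, on growing finite boxes and avoid the nowhere dense sets.
   The limit tree keeps rank exactly alpha because every requirement "below nu there is a child
   of rank at least gamma" is met infinitely often. Hence A alpha is not in I*, so I* is proper,
   and the aleph_1 sets A alpha witness the failure of ccc.

   Every Borel set has the Baire property in each tau alpha, since the inclusion of A alpha into
   2^(omega^<omega) is continuous. So a Borel set B outside I* is comeager in some basic open set V
   of some tau alpha with alpha > 0. In an I*-almost disjoint family, distinct members get distinct
   pairs (alpha, V). Each tau alpha is second countable, so there are only aleph_1 such pairs. *)

theory Submission
  imports Defs "HOL-Library.Countable_Set_Type"
begin

unbundle cardinal_syntax

section \<open>Countable ordinals\<close>

lemma Card_order_W: "Card_order W"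
  by (simp add: cardSuc_Card_order natLeq_Card_order)

lemma wo_rel_W: "wo_rel W"
  using Card_order_W unfolding wo_rel_def card_order_on_def by blast

lemma infinite_Field_W: "infinite (Field W)"
  using cardSuc_finite[OF natLeq_Card_order] by (simp add: Field_natLeq)

lemma uncountable_Field_W: "uncountable (Field W)"
proof
  assume "countable (Field W)"
  then have "|Field W| \<le>o natLeq" by (simp add: countable_card_le_natLeq)
  moreover have "|Field W| =o W" using Card_order_W card_of_Field_ordIso by blast
  ultimately have "W \<le>o natLeq" by (meson ordIso_ordLeq_trans ordIso_symmetric)
  moreover have "natLeq <o W" by (simp add: cardSuc_greater natLeq_Card_order)
  ultimately show False using not_ordLess_ordLeq by metis
qed

lemma countable_underS_W: "countable (underS W a)"
proof (cases "a \<in> Field W")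
  case True
  have "|underS W a| <o W" using card_of_underS[OF Card_order_W True] .
  then have "|underS W a| \<le>o natLeq"
    using cardSuc_ordLeq_ordLess[OF natLeq_Card_order card_of_Card_order[of "underS W a"]] by simp
  then show ?thesis by (simp add: countable_card_le_natLeq)
next
  case False
  then have "underS W a = {}" unfolding underS_def Field_def by auto
  then show ?thesis by simp
qed

lemma W_refl: "a \<in> Field W \<Longrightarrow> (a, a) \<in> W"
  using wo_rel.REFL[OF wo_rel_W] by (auto simp: refl_on_def)

lemma W_trans: "(a, b) \<in> W \<Longrightarrow> (b, c) \<in> W \<Longrightarrow> (a, c) \<in> W"
  using wo_rel.TRANS[OF wo_rel_W] by (auto simp: trans_def)

lemma W_antisym: "(a, b) \<in> W \<Longrightarrow> (b, a) \<in> W \<Longrightarrow> a = b"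
  using wo_rel.ANTISYM[OF wo_rel_W] by (auto simp: antisym_def)

lemma W_total: "a \<in> Field W \<Longrightarrow> b \<in> Field W \<Longrightarrow> (a, b) \<in> W \<or> (b, a) \<in> W"
  using wo_rel.TOTALS[OF wo_rel_W] by blast

lemma W_not_le_iff: "a \<in> Field W \<Longrightarrow> b \<in> Field W \<Longrightarrow> (a, b) \<notin> W \<longleftrightarrow> b \<in> underS W a"
  using W_total W_refl W_antisym unfolding underS_def by blast

lemma underS_W_le_trans: "a \<in> underS W b \<Longrightarrow> (b, c) \<in> W \<Longrightarrow> a \<in> underS W c"
  unfolding underS_def using W_trans W_antisym by blast

lemma le_underS_W_trans: "(a, b) \<in> W \<Longrightarrow> b \<in> underS W c \<Longrightarrow> a \<in> underS W c"
  unfolding underS_def using W_trans W_antisym by blast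

lemma wf_W: "wf (W - Id)"
  using wo_rel.WF[OF wo_rel_W] .

lemma countable_bounded_W:
  assumes "countable B" "B \<subseteq> Field W"
  shows "\<exists>i\<in>Field W. \<forall>b\<in>B. (b, i) \<in> W"
proof -
  have "relChain W (under W)"
    unfolding relChain_def under_def using W_trans by blast
  moreover have "B \<subseteq> (\<Union>i\<in>Field W. under W i)"
    using assms(2) W_refl unfolding under_def by blast
  moreover have "|B| \<le>o natLeq" using assms(1) by (simp add: countable_card_le_natLeq)
  ultimately have "\<exists>i\<in>Field W. B \<subseteq> under W i"
    using cardSuc_UNION[OF natLeq_Card_order] by (simp add: Field_natLeq)
  then show ?thesis unfolding under_def by blast
qed

lemma W_no_greatest: "a \<in> Field W \<Longrightarrow> \<exists>b. a \<in> underS W b"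
proof -
  assume a: "a \<in> Field W"
  have "Field W \<noteq> under W a"
    using Card_order_infinite_not_under[OF Card_order_W infinite_Field_W] by blast
  moreover have "under W a \<subseteq> Field W" unfolding under_def Field_def by auto
  ultimately obtain b where "b \<in> Field W" "(b, a) \<notin> W" unfolding under_def by blast
  then show ?thesis using W_not_le_iff a by blast
qed

lemma AboveS_W_singleton: "a \<in> Field W \<Longrightarrow> AboveS W {a} \<noteq> {}"
  using W_no_greatest unfolding AboveS_def underS_def by (blast intro: FieldI2)

lemma ord_succ_Field: "a \<in> Field W \<Longrightarrow> ord_succ a \<in> Field W"
  unfolding ord_succ_def by (rule wo_rel.suc_inField[OF wo_rel_W _ AboveS_W_singleton]) auto

lemma ord_succ_le_iff:
  assumes a: "a \<in> Field W"
  shows "(ord_succ a, b) \<in> W \<longleftrightarrow> a \<in> underS W b"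
proof
  have less: "a \<in> underS W (ord_succ a)"
    using wo_rel.suc_greater[OF wo_rel_W _ AboveS_W_singleton[OF a]] a
    unfolding ord_succ_def underS_def by blast
  show "a \<in> underS W b" if "(ord_succ a, b) \<in> W"
    using underS_W_le_trans[OF less that] .
  show "(ord_succ a, b) \<in> W" if "a \<in> underS W b"
    using that unfolding ord_succ_def underS_def
    by (intro wo_rel.suc_least_AboveS[OF wo_rel_W]) (auto simp: AboveS_def intro: FieldI2)
qed

lemma
  assumes "countable B" "B \<subseteq> Field W"
  shows ord_sup_Field: "ord_sup B \<in> Field W"
    and ord_sup_upper: "b \<in> B \<Longrightarrow> (b, ord_sup B) \<in> W"
    and ord_sup_least: "c \<in> Field W \<Longrightarrow> \<forall>b\<in>B. (b, c) \<in> W \<Longrightarrow> (ord_sup B, c) \<in> W"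
proof -
  have ne: "Above W B \<noteq> {}" using countable_bounded_W[OF assms] unfolding Above_def by blast
  have sub: "Above W B \<subseteq> Field W" unfolding Above_def by blast
  have "ord_sup B \<in> Above W B" unfolding ord_sup_def wo_rel.supr_def[OF wo_rel_W]
    using wo_rel.minim_in[OF wo_rel_W sub ne] .
  then show "ord_sup B \<in> Field W" "b \<in> B \<Longrightarrow> (b, ord_sup B) \<in> W"
    unfolding Above_def by auto
  show "c \<in> Field W \<Longrightarrow> \<forall>b\<in>B. (b, c) \<in> W \<Longrightarrow> (ord_sup B, c) \<in> W"
    unfolding ord_sup_def wo_rel.supr_def[OF wo_rel_W]
    using wo_rel.minim_least[OF wo_rel_W sub] by (simp add: Above_def)
qed

lemma ord_sup_succ_le_iff:
  assumes P: "countable {k. P k}" and g: "\<And>k. P k \<Longrightarrow> g k \<in> Field W" and c: "c \<in> Field W"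
  shows "(ord_sup {ord_succ (g k) | k. P k}, c) \<in> W \<longleftrightarrow> (\<forall>k. P k \<longrightarrow> g k \<in> underS W c)"
proof -
  let ?S = "{ord_succ (g k) | k. P k}"
  have "?S = (ord_succ \<circ> g) ` {k. P k}" by auto
  then have S: "countable ?S" "?S \<subseteq> Field W" using P g ord_succ_Field by auto
  have "(ord_sup ?S, c) \<in> W \<longleftrightarrow> (\<forall>s\<in>?S. (s, c) \<in> W)"
    using ord_sup_least[OF S c] ord_sup_upper[OF S] W_trans by blast
  also have "\<dots> \<longleftrightarrow> (\<forall>k. P k \<longrightarrow> g k \<in> underS W c)"
    using ord_succ_le_iff g by blast
  finally show ?thesis .
qed

lemma ord_sup_succ_eq_iff:
  assumes P: "countable {k. P k}" and g: "\<And>k. P k \<Longrightarrow> g k \<in> Field W" and c: "c \<in> Field W"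
  shows "c = ord_sup {ord_succ (g k) | k. P k} \<longleftrightarrow>
    (\<forall>k. P k \<longrightarrow> g k \<in> underS W c) \<and> (\<forall>\<gamma>\<in>underS W c. \<exists>k. P k \<and> (\<gamma>, g k) \<in> W)"
proof -
  let ?s = "ord_sup {ord_succ (g k) | k. P k}"
  have "?s \<in> Field W"
    by (rule ord_sup_Field) (use P g ord_succ_Field in \<open>auto simp: setcompr_eq_image\<close>)
  have le_iff: "(?s, d) \<in> W \<longleftrightarrow> (\<forall>k. P k \<longrightarrow> g k \<in> underS W d)" if "d \<in> Field W" for d
    using ord_sup_succ_le_iff[OF P g that] .
  have "(c, ?s) \<notin> W \<longleftrightarrow> ?s \<in> underS W c"
    using W_not_le_iff[OF c \<open>?s \<in> Field W\<close>] .
  also have "\<dots> \<longleftrightarrow> (\<exists>\<gamma>\<in>underS W c. (?s, \<gamma>) \<in> W)"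
    using W_refl[OF \<open>?s \<in> Field W\<close>] le_underS_W_trans[of ?s _ c] by blast
  also have "\<dots> \<longleftrightarrow> (\<exists>\<gamma>\<in>underS W c. \<forall>k. P k \<longrightarrow> (\<gamma>, g k) \<notin> W)"
  proof (intro bex_cong refl)
    fix \<gamma> assume "\<gamma> \<in> underS W c"
    then have "\<gamma> \<in> Field W" unfolding underS_def by (blast intro: FieldI1)
    then show "(?s, \<gamma>) \<in> W \<longleftrightarrow> (\<forall>k. P k \<longrightarrow> (\<gamma>, g k) \<notin> W)"
      using le_iff W_not_le_iff g by simp
  qed
  finally have "(c, ?s) \<in> W \<longleftrightarrow> (\<forall>\<gamma>\<in>underS W c. \<exists>k. P k \<and> (\<gamma>, g k) \<in> W)"
    by blast
  then show ?thesis
    using le_iff[OF c] W_antisym W_refl[OF c] by blast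
qed

section \<open>Rank functions of well-founded trees\<close>

lemma Tr_take: "T \<in> Tr \<Longrightarrow> s \<in> T \<Longrightarrow> take n s \<in> T"
  unfolding Tr_def by blast

lemma Tr_prefix: "T \<in> Tr \<Longrightarrow> \<nu> @ \<mu> \<in> T \<Longrightarrow> \<nu> \<in> T"
  using Tr_take[of T "\<nu> @ \<mu>" "length \<nu>"] by simp

lemma Trw_imp_Tr: "T \<in> Trw \<Longrightarrow> T \<in> Tr"
  unfolding Trw_def by blast

definition is_rank :: "nat list set \<Rightarrow> (nat list \<Rightarrow> nat set) \<Rightarrow> bool" where
  "is_rank T f \<longleftrightarrow> (\<forall>\<nu>\<in>T. f \<nu> \<in> Field W \<and>
      f \<nu> = ord_sup {ord_succ (f (\<nu> @ [k])) | k. \<nu> @ [k] \<in> T})"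

lemma is_rank_iff:
  "is_rank T f \<longleftrightarrow> (\<forall>\<nu>\<in>T. f \<nu> \<in> Field W
      \<and> (\<forall>k. \<nu> @ [k] \<in> T \<longrightarrow> f (\<nu> @ [k]) \<in> underS W (f \<nu>))
      \<and> (\<forall>\<gamma>\<in>underS W (f \<nu>). \<exists>k. \<nu> @ [k] \<in> T \<and> (\<gamma>, f (\<nu> @ [k])) \<in> W))"
proof -
  have "f \<nu> = ord_sup {ord_succ (f (\<nu> @ [k])) | k. \<nu> @ [k] \<in> T} \<longleftrightarrow>
      (\<forall>k. \<nu> @ [k] \<in> T \<longrightarrow> f (\<nu> @ [k]) \<in> underS W (f \<nu>))
      \<and> (\<forall>\<gamma>\<in>underS W (f \<nu>). \<exists>k. \<nu> @ [k] \<in> T \<and> (\<gamma>, f (\<nu> @ [k])) \<in> W)"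
    if "\<forall>\<mu>\<in>T. f \<mu> \<in> Field W" "\<nu> \<in> T" for \<nu>
    by (rule ord_sup_succ_eq_iff[OF countableI_type]) (use that in auto)
  then show ?thesis
    unfolding is_rank_def by blast
qed

lemma is_rank_child: "is_rank T f \<Longrightarrow> \<nu> \<in> T \<Longrightarrow> \<nu> @ [k] \<in> T \<Longrightarrow> f (\<nu> @ [k]) \<in> underS W (f \<nu>)"
  unfolding is_rank_iff by (elim ballE conjE allE impE) auto

lemma is_rank_imp_Trw:
  assumes T: "T \<in> Tr" and f: "is_rank T f"
  shows "T \<in> Trw"
proof -
  have "\<not> (\<forall>n. map x [0..<n] \<in> T)" for x :: "nat \<Rightarrow> nat"
  proof
    assume x: "\<forall>n. map x [0..<n] \<in> T"
    have "f (map x [0..<Suc n]) \<in> underS W (f (map x [0..<n]))" for n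
      using is_rank_child[OF f, of "map x [0..<n]" "x n"] x[rule_format, of n] x[rule_format, of "Suc n"]
      by simp
    then have "(f (map x [0..<Suc n]), f (map x [0..<n])) \<in> W - Id" for n
      unfolding underS_def by blast
    then have "\<exists>g. \<forall>i. (g (Suc i), g i) \<in> W - Id"
      by (intro exI[of _ "\<lambda>n. f (map x [0..<n])"]) blast
    then show False using wf_W unfolding wf_iff_no_infinite_down_chain by blast
  qed
  then show ?thesis using T unfolding Trw_def by blast
qed

lemma is_rank_unique:
  assumes f: "is_rank T f" and g: "is_rank T g"
  shows "\<nu> \<in> T \<Longrightarrow> f \<nu> = g \<nu>"
proof (induction "f \<nu>" arbitrary: \<nu> rule: wf_induct_rule[OF wf_W, case_names less])
  case less
  have "f (\<nu> @ [k]) = g (\<nu> @ [k])" if "\<nu> @ [k] \<in> T" for k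
  proof (rule less(1))
    show "(f (\<nu> @ [k]), f \<nu>) \<in> W - Id"
      using is_rank_child[OF f less.prems that] unfolding underS_def by blast
  qed (rule that)
  then have "{ord_succ (f (\<nu> @ [k])) | k. \<nu> @ [k] \<in> T} = {ord_succ (g (\<nu> @ [k])) | k. \<nu> @ [k] \<in> T}"
    unfolding setcompr_eq_image by (intro image_cong) auto
  moreover have "f \<nu> = ord_sup {ord_succ (f (\<nu> @ [k])) | k. \<nu> @ [k] \<in> T}"
    and "g \<nu> = ord_sup {ord_succ (g (\<nu> @ [k])) | k. \<nu> @ [k] \<in> T}"
    using f g less.prems unfolding is_rank_def by blast+
  ultimately show ?case by simp
qed

text \<open>An infinite descending chain of children extends its first node to an infinite branch.\<close>

lemma wf_child_rel:
  assumes T: "T \<in> Trw"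
  shows "wf {(\<nu> @ [k], \<nu>) | \<nu> k. \<nu> @ [k] \<in> T}"
proof (rule ccontr)
  assume "\<not> ?thesis"
  then obtain c where "\<forall>i. (c (Suc i), c i) \<in> {(\<nu> @ [k], \<nu>) | \<nu> k. \<nu> @ [k] \<in> T}"
    unfolding wf_iff_no_infinite_down_chain by blast
  then have c: "\<And>i. \<exists>k. c (Suc i) = c i @ [k] \<and> c (Suc i) \<in> T"
    by fastforce
  have len: "length (c j) = length (c 0) + j" for j
  proof (induction j)
    case (Suc j)
    then show ?case using c[of j] by auto
  qed simp
  have prefix: "i \<le> j \<Longrightarrow> take (length (c i)) (c j) = c i" for i j
  proof (induction j rule: dec_induct)
    case (step j)
    obtain k where "c (Suc j) = c j @ [k]" using c[of j] by blast
    then show ?case using step len[of i] len[of j] by simp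
  qed simp
  define x where "x n = c (Suc n) ! n" for n
  have "map x [0..<n] = take n (c (Suc n))" for n
  proof (rule nth_equalityI)
    fix j assume "j < length (map x [0..<n])"
    then have "j < n" by simp
    then have "c (Suc j) ! j = take (length (c (Suc j))) (c (Suc n)) ! j"
      using prefix[of "Suc j" "Suc n"] by simp
    then show "map x [0..<n] ! j = take n (c (Suc n)) ! j"
      using len[of "Suc j"] \<open>j < n\<close> unfolding x_def by simp
  qed (use len[of "Suc n"] in simp)
  then have "map x [0..<n] \<in> T" for n
    using Tr_take[OF Trw_imp_Tr[OF T], of "c (Suc n)" n] c[of n] by simp
  then show False using T unfolding Trw_def by blast
qed

lemma Trw_has_rank:
  assumes T: "T \<in> Trw"
  obtains f where "is_rank T f" "\<And>\<nu>. \<nu> \<notin> T \<Longrightarrow> f \<nu> = undefined"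
proof -
  define R where "R = {(\<nu> @ [k], \<nu>) | \<nu> k. \<nu> @ [k] \<in> T}"
  define f where "f = wfrec R (\<lambda>f \<nu>. if \<nu> \<in> T
    then ord_sup {ord_succ (f (\<nu> @ [k])) | k. \<nu> @ [k] \<in> T} else undefined)"
  have f_eq: "f \<nu> = (if \<nu> \<in> T then ord_sup {ord_succ (f (\<nu> @ [k])) | k. \<nu> @ [k] \<in> T}
    else undefined)" for \<nu>
  proof -
    have "\<nu> @ [k] \<in> T \<Longrightarrow> cut f R \<nu> (\<nu> @ [k]) = f (\<nu> @ [k])" for k
      by (rule cut_apply) (auto simp: R_def)
    then have "{ord_succ (cut f R \<nu> (\<nu> @ [k])) | k. \<nu> @ [k] \<in> T} =
        {ord_succ (f (\<nu> @ [k])) | k. \<nu> @ [k] \<in> T}"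
      unfolding setcompr_eq_image by (intro image_cong) auto
    moreover have "f \<nu> = (if \<nu> \<in> T then ord_sup {ord_succ (cut f R \<nu> (\<nu> @ [k])) | k. \<nu> @ [k] \<in> T}
        else undefined)"
      unfolding f_def by (rule wfrec[OF wf_child_rel[OF T, folded R_def]])
    ultimately show ?thesis by simp
  qed
  have "\<nu> \<in> T \<longrightarrow> f \<nu> \<in> Field W" for \<nu>
  proof (induction \<nu> rule: wf_induct_rule[OF wf_child_rel[OF T], case_names less])
    case (less \<nu>)
    show ?case
      using f_eq[of \<nu>] less ord_sup_Field ord_succ_Field
      by (auto simp: setcompr_eq_image intro!: ord_sup_Field)
  qed
  then have "is_rank T f" unfolding is_rank_def using f_eq by auto
  then show ?thesis using that f_eq by simp
qed

lemma is_rank_rank_fun: "T \<in> Trw \<Longrightarrow> is_rank T (rank_fun T)"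
proof -
  assume T: "T \<in> Trw"
  obtain f where f: "is_rank T f" "\<And>\<nu>. \<nu> \<notin> T \<Longrightarrow> f \<nu> = undefined"
    using Trw_has_rank[OF T] by blast
  have unique: "g = f" if "is_rank T g" "\<forall>\<nu>. \<nu> \<notin> T \<longrightarrow> g \<nu> = undefined" for g
  proof
    show "g \<nu> = f \<nu>" for \<nu>
      using is_rank_unique[OF that(1) f(1)] that(2) f(2) by (cases "\<nu> \<in> T") auto
  qed
  have "rank_fun T = (THE g. is_rank T g \<and> (\<forall>\<nu>. \<nu> \<notin> T \<longrightarrow> g \<nu> = undefined))"
    unfolding rank_fun_def is_rank_def ..
  also have "\<dots> = f"
    by (rule the_equality) (use f unique in blast)+
  finally show ?thesis using f(1) by simp
qed

lemma rank_fun_eqI: "T \<in> Tr \<Longrightarrow> is_rank T f \<Longrightarrow> \<nu> \<in> T \<Longrightarrow> rank_fun T \<nu> = f \<nu>"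
  using is_rank_unique[OF is_rank_rank_fun[OF is_rank_imp_Trw]] by blast

lemma rank_fun_Field: "T \<in> Trw \<Longrightarrow> \<nu> \<in> T \<Longrightarrow> rank_fun T \<nu> \<in> Field W"
  using is_rank_rank_fun unfolding is_rank_def by blast

lemma rank_fun_child:
  "T \<in> Trw \<Longrightarrow> \<nu> @ [k] \<in> T \<Longrightarrow> rank_fun T (\<nu> @ [k]) \<in> underS W (rank_fun T \<nu>)"
  using is_rank_child[OF is_rank_rank_fun] Tr_prefix Trw_imp_Tr by blast

lemma rank_fun_witness:
  "T \<in> Trw \<Longrightarrow> \<nu> \<in> T \<Longrightarrow> \<gamma> \<in> underS W (rank_fun T \<nu>) \<Longrightarrow>
    \<exists>k. \<nu> @ [k] \<in> T \<and> (\<gamma>, rank_fun T (\<nu> @ [k])) \<in> W"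
  using is_rank_rank_fun unfolding is_rank_iff by blast

lemma rank_fun_le_root:
  assumes T: "T \<in> Trw"
  shows "\<nu> \<in> T \<Longrightarrow> (rank_fun T \<nu>, rank_fun T []) \<in> W"
proof (induction \<nu> rule: rev_induct)
  case Nil
  then show ?case using W_refl rank_fun_Field[OF T] by blast
next
  case (snoc k \<nu>)
  then show ?case
    using rank_fun_child[OF T snoc.prems] Tr_prefix[OF Trw_imp_Tr[OF T] snoc.prems] W_trans
    unfolding underS_def by blast
qed

lemma rank_fun_le_iff:
  assumes T: "T \<in> Trw" and \<nu>: "\<nu> \<in> T" and \<beta>: "\<beta> \<in> Field W"
  shows "(rank_fun T \<nu>, \<beta>) \<in> W \<longleftrightarrow> (\<forall>k. \<nu> @ [k] \<in> T \<longrightarrow> rank_fun T (\<nu> @ [k]) \<in> underS W \<beta>)"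
proof -
  have "rank_fun T \<nu> = ord_sup {ord_succ (rank_fun T (\<nu> @ [k])) | k. \<nu> @ [k] \<in> T}"
    using is_rank_rank_fun[OF T] \<nu> unfolding is_rank_def by blast
  moreover have "\<And>k. \<nu> @ [k] \<in> T \<Longrightarrow> rank_fun T (\<nu> @ [k]) \<in> Field W"
    using rank_fun_Field[OF T] .
  ultimately show ?thesis
    using ord_sup_succ_le_iff[where P="\<lambda>k. \<nu> @ [k] \<in> T" and g="\<lambda>k. rank_fun T (\<nu> @ [k])",
        OF countableI_type _ \<beta>] by simp
qed

lemma rank_fun_eq_iff:
  assumes T: "T \<in> Trw" and \<nu>: "\<nu> \<in> T" and c: "c \<in> Field W"
  shows "c = rank_fun T \<nu> \<longleftrightarrow> (\<forall>k. \<nu> @ [k] \<in> T \<longrightarrow> rank_fun T (\<nu> @ [k]) \<in> underS W c)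
    \<and> (\<forall>\<gamma>\<in>underS W c. \<exists>k. \<nu> @ [k] \<in> T \<and> (\<gamma>, rank_fun T (\<nu> @ [k])) \<in> W)"
proof -
  have "rank_fun T \<nu> = ord_sup {ord_succ (rank_fun T (\<nu> @ [k])) | k. \<nu> @ [k] \<in> T}"
    using is_rank_rank_fun[OF T] \<nu> unfolding is_rank_def by blast
  moreover have "\<And>k. \<nu> @ [k] \<in> T \<Longrightarrow> rank_fun T (\<nu> @ [k]) \<in> Field W"
    using rank_fun_Field[OF T] .
  ultimately show ?thesis
    using ord_sup_succ_eq_iff[where P="\<lambda>k. \<nu> @ [k] \<in> T" and g="\<lambda>k. rank_fun T (\<nu> @ [k])",
        OF countableI_type _ c] by simp
qed

definition subtree :: "nat list set \<Rightarrow> nat list \<Rightarrow> nat list set" where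
  "subtree T \<nu> = {s. \<nu> @ s \<in> T}"

lemma mem_subtree [simp]: "s \<in> subtree T \<nu> \<longleftrightarrow> \<nu> @ s \<in> T"
  unfolding subtree_def by simp

lemma subtree_subtree [simp]: "subtree (subtree T \<nu>) \<mu> = subtree T (\<nu> @ \<mu>)"
  unfolding subtree_def by simp

lemma subtree_Nil [simp]: "subtree T [] = T"
  unfolding subtree_def by simp

lemma subtree_Tr: "T \<in> Tr \<Longrightarrow> subtree T \<nu> \<in> Tr"
  unfolding Tr_def subtree_def
proof clarsimp
  fix s n assume "\<forall>s\<in>T. \<forall>n. take n s \<in> T" "\<nu> @ s \<in> T"
  then have "take (length \<nu> + n) (\<nu> @ s) \<in> T" by blast
  then show "\<nu> @ take n s \<in> T" by simp
qed

lemma is_rank_subtree: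
  assumes T: "T \<in> Trw"
  shows "is_rank (subtree T \<nu>) (\<lambda>s. rank_fun T (\<nu> @ s))"
  unfolding is_rank_def
proof
  fix s assume "s \<in> subtree T \<nu>"
  then have "\<nu> @ s \<in> T" by simp
  then have "rank_fun T (\<nu> @ s) \<in> Field W \<and>
      rank_fun T (\<nu> @ s) = ord_sup {ord_succ (rank_fun T ((\<nu> @ s) @ [k])) | k. (\<nu> @ s) @ [k] \<in> T}"
    using is_rank_rank_fun[OF T] unfolding is_rank_def by blast
  then show "rank_fun T (\<nu> @ s) \<in> Field W \<and> rank_fun T (\<nu> @ s) =
      ord_sup {ord_succ (rank_fun T (\<nu> @ (s @ [k]))) | k. s @ [k] \<in> subtree T \<nu>}"
    unfolding append_assoc mem_subtree .
qed

lemma subtree_Trw: "T \<in> Trw \<Longrightarrow> subtree T \<nu> \<in> Trw"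
  using is_rank_imp_Trw[OF subtree_Tr[OF Trw_imp_Tr] is_rank_subtree] .

lemma rank_fun_subtree: "T \<in> Trw \<Longrightarrow> \<nu> @ s \<in> T \<Longrightarrow> rank_fun (subtree T \<nu>) s = rank_fun T (\<nu> @ s)"
  using rank_fun_eqI[OF subtree_Tr[OF Trw_imp_Tr] is_rank_subtree] by simp

lemma Trw_if_subtrees_Trw:
  assumes T: "T \<in> Tr" and sub: "\<And>k. [k] \<in> T \<Longrightarrow> subtree T [k] \<in> Trw"
  shows "T \<in> Trw"
proof -
  have "\<not> (\<forall>n. map x [0..<n] \<in> T)" for x :: "nat \<Rightarrow> nat"
  proof
    assume x: "\<forall>n. map x [0..<n] \<in> T"
    then have "[x 0] \<in> T" using x[rule_format, of 1] by simp
    moreover have "map (\<lambda>i. x (Suc i)) [0..<n] \<in> subtree T [x 0]" for n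
    proof -
      have "x 0 # map (\<lambda>i. x (Suc i)) [0..<n] \<in> T"
        using x[rule_format, of "Suc n"] by (simp only: map_upt_Suc)
      then show ?thesis by simp
    qed
    ultimately show False using sub unfolding Trw_def by blast
  qed
  then show ?thesis using T unfolding Trw_def by blast
qed

lemma Trw_rank_root_le_iff:
  assumes T: "T \<in> Tr" "[] \<in> T" and \<beta>: "\<beta> \<in> Field W"
  shows "T \<in> Trw \<and> (rank_fun T [], \<beta>) \<in> W \<longleftrightarrow>
    (\<forall>k. [k] \<in> T \<longrightarrow> subtree T [k] \<in> Trw \<and> rank_fun (subtree T [k]) [] \<in> underS W \<beta>)"
proof
  assume "T \<in> Trw \<and> (rank_fun T [], \<beta>) \<in> W"
  then show "\<forall>k. [k] \<in> T \<longrightarrow> subtree T [k] \<in> Trw \<and> rank_fun (subtree T [k]) [] \<in> underS W \<beta>"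
    using rank_fun_le_iff[OF _ T(2) \<beta>] rank_fun_subtree[where s="[]"] subtree_Trw by simp
next
  assume sub: "\<forall>k. [k] \<in> T \<longrightarrow> subtree T [k] \<in> Trw \<and> rank_fun (subtree T [k]) [] \<in> underS W \<beta>"
  then have "T \<in> Trw" using Trw_if_subtrees_Trw[OF T(1)] by blast
  then show "T \<in> Trw \<and> (rank_fun T [], \<beta>) \<in> W"
    using rank_fun_le_iff[OF _ T(2) \<beta>] rank_fun_subtree[where s="[]"] sub by simp
qed

definition graft :: "('a \<Rightarrow> nat) \<Rightarrow> 'a set \<Rightarrow> ('a \<Rightarrow> nat list set) \<Rightarrow> nat list set" where
  "graft e D t = insert [] {e \<gamma> # s | \<gamma> s. \<gamma> \<in> D \<and> s \<in> t \<gamma>}"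

lemma
  assumes e: "inj_on e D" and t: "\<And>\<gamma>. \<gamma> \<in> D \<Longrightarrow> t \<gamma> \<in> Trw" "\<And>\<gamma>. \<gamma> \<in> D \<Longrightarrow> [] \<in> t \<gamma>"
  shows subtree_graft: "\<gamma> \<in> D \<Longrightarrow> subtree (graft e D t) [e \<gamma>] = t \<gamma>"
    and singleton_in_graft_iff: "[k] \<in> graft e D t \<longleftrightarrow> k \<in> e ` D"
    and graft_Trw: "graft e D t \<in> Trw"
proof -
  show sub: "subtree (graft e D t) [e \<gamma>] = t \<gamma>" if "\<gamma> \<in> D" for \<gamma>
    using that unfolding graft_def subtree_def by (auto simp: inj_on_eq_iff[OF e])
  show child: "[k] \<in> graft e D t \<longleftrightarrow> k \<in> e ` D" for k
    using t(2) unfolding graft_def by auto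
  have "graft e D t \<in> Tr"
    unfolding Tr_def
  proof (intro CollectI ballI allI)
    fix s n assume "s \<in> graft e D t"
    then consider "s = []" | \<gamma> s' where "\<gamma> \<in> D" "s' \<in> t \<gamma>" "s = e \<gamma> # s'"
      unfolding graft_def by blast
    then show "take n s \<in> graft e D t"
    proof cases
      case 2
      then have "take (n - 1) s' \<in> t \<gamma>" using Tr_take[OF Trw_imp_Tr[OF t(1)]] by blast
      then show ?thesis using 2 unfolding graft_def by (cases n) auto
    qed (simp add: graft_def)
  qed
  then show "graft e D t \<in> Trw"
  proof (rule Trw_if_subtrees_Trw)
    fix k assume "[k] \<in> graft e D t"
    then obtain \<gamma> where "\<gamma> \<in> D" "k = e \<gamma>" using child by blast
    then show "subtree (graft e D t) [k] \<in> Trw" using sub t(1) by simp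
  qed
qed

text \<open>Graft trees of all smaller ranks below a new root.\<close>

lemma A_nonempty: "\<alpha> \<in> Field W \<Longrightarrow> A \<alpha> \<noteq> {}"
proof (induction \<alpha> rule: wf_induct_rule[OF wf_W, case_names less])
  case (less \<alpha>)
  define D where "D = underS W \<alpha>"
  have "\<forall>\<gamma>\<in>D. \<exists>T. T \<in> A \<gamma>"
    using less unfolding D_def underS_def by (blast intro: FieldI1)
  then obtain t where "\<And>\<gamma>. \<gamma> \<in> D \<Longrightarrow> t \<gamma> \<in> A \<gamma>" by metis
  then have t: "\<And>\<gamma>. \<gamma> \<in> D \<Longrightarrow> t \<gamma> \<in> Trw" "\<And>\<gamma>. \<gamma> \<in> D \<Longrightarrow> [] \<in> t \<gamma>"
    and t_rank: "\<And>\<gamma>. \<gamma> \<in> D \<Longrightarrow> rank_fun (t \<gamma>) [] = \<gamma>"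
    unfolding A_def by auto
  have e: "inj_on (to_nat_on D) D" unfolding D_def by (intro inj_on_to_nat_on countable_underS_W)
  define T where "T = graft (to_nat_on D) D t"
  have T: "T \<in> Trw" "[] \<in> T" unfolding T_def using graft_Trw[OF e t] by (auto simp: graft_def)
  have child: "[k] \<in> T \<longleftrightarrow> k \<in> to_nat_on D ` D" for k
    unfolding T_def using singleton_in_graft_iff[OF e t] .
  have rank_child: "rank_fun T [to_nat_on D \<gamma>] = \<gamma>" if "\<gamma> \<in> D" for \<gamma>
    using rank_fun_subtree[OF T(1), of "[to_nat_on D \<gamma>]" "[]"] child that t_rank
      subtree_graft[OF e t that] unfolding T_def by simp
  have "\<forall>k. [k] \<in> T \<longrightarrow> rank_fun T [k] \<in> D"
    using child rank_child by auto
  moreover have "\<forall>\<gamma>\<in>D. \<exists>k. [k] \<in> T \<and> (\<gamma>, rank_fun T [k]) \<in> W"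
  proof
    fix \<gamma> assume "\<gamma> \<in> D"
    moreover have "\<gamma> \<in> Field W"
      using \<open>\<gamma> \<in> D\<close> unfolding D_def underS_def by (blast intro: FieldI1)
    ultimately have "[to_nat_on D \<gamma>] \<in> T" "(\<gamma>, rank_fun T [to_nat_on D \<gamma>]) \<in> W"
      using child rank_child W_refl by auto
    then show "\<exists>k. [k] \<in> T \<and> (\<gamma>, rank_fun T [k]) \<in> W" by blast
  qed
  ultimately have "\<alpha> = rank_fun T []"
    using rank_fun_eq_iff[OF T less.prems] unfolding D_def by simp
  then show ?case using T unfolding A_def by blast
qed

section \<open>Borelness of the sets A\<close>

definition rank_bounded_at :: "nat set \<Rightarrow> nat list \<Rightarrow> nat list set set" where
  "rank_bounded_at \<beta> \<nu> =
    {T \<in> Tr. \<nu> \<in> T \<longrightarrow> subtree T \<nu> \<in> Trw \<and> (rank_fun (subtree T \<nu>) [], \<beta>) \<in> W}"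

lemma mem_rank_bounded_at:
  "T \<in> Tr \<Longrightarrow> \<nu> \<in> T \<Longrightarrow>
    T \<in> rank_bounded_at \<beta> \<nu> \<longleftrightarrow> subtree T \<nu> \<in> Trw \<and> (rank_fun (subtree T \<nu>) [], \<beta>) \<in> W"
  unfolding rank_bounded_at_def by blast

lemma ex_rank_bounded_at_below_iff:
  assumes T: "T \<in> Tr" "\<nu> \<in> T"
  shows "(\<exists>\<gamma>\<in>underS W \<beta>. T \<in> rank_bounded_at \<gamma> \<nu>) \<longleftrightarrow>
    subtree T \<nu> \<in> Trw \<and> rank_fun (subtree T \<nu>) [] \<in> underS W \<beta>"
proof
  assume "\<exists>\<gamma>\<in>underS W \<beta>. T \<in> rank_bounded_at \<gamma> \<nu>"
  then show "subtree T \<nu> \<in> Trw \<and> rank_fun (subtree T \<nu>) [] \<in> underS W \<beta>"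
    using mem_rank_bounded_at[OF T] le_underS_W_trans by blast
next
  assume *: "subtree T \<nu> \<in> Trw \<and> rank_fun (subtree T \<nu>) [] \<in> underS W \<beta>"
  then have "(rank_fun (subtree T \<nu>) [], rank_fun (subtree T \<nu>) []) \<in> W"
    using W_refl rank_fun_Field T(2) by simp
  then show "\<exists>\<gamma>\<in>underS W \<beta>. T \<in> rank_bounded_at \<gamma> \<nu>"
    using * mem_rank_bounded_at[OF T] by blast
qed

lemma rank_bounded_at_rec:
  assumes \<beta>: "\<beta> \<in> Field W"
  shows "rank_bounded_at \<beta> \<nu> = {T \<in> Tr. \<nu> \<notin> T} \<union> (Tr \<inter> (\<Inter>k. {T \<in> Tr. \<nu> @ [k] \<notin> T} \<union>
    (\<Union>\<gamma>\<in>underS W \<beta>. rank_bounded_at \<gamma> (\<nu> @ [k]))))"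
proof -
  have rec: "T \<in> rank_bounded_at \<beta> \<nu> \<longleftrightarrow>
      (\<forall>k. \<nu> @ [k] \<in> T \<longrightarrow> (\<exists>\<gamma>\<in>underS W \<beta>. T \<in> rank_bounded_at \<gamma> (\<nu> @ [k])))"
    if T: "T \<in> Tr" "\<nu> \<in> T" for T
  proof -
    have "subtree T \<nu> \<in> Tr" "[] \<in> subtree T \<nu>" using subtree_Tr T by auto
    from Trw_rank_root_le_iff[OF this \<beta>]
    have "T \<in> rank_bounded_at \<beta> \<nu> \<longleftrightarrow> (\<forall>k. \<nu> @ [k] \<in> T \<longrightarrow>
        subtree T (\<nu> @ [k]) \<in> Trw \<and> rank_fun (subtree T (\<nu> @ [k])) [] \<in> underS W \<beta>)"
      using mem_rank_bounded_at[OF T] by simp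
    then show ?thesis using ex_rank_bounded_at_below_iff[OF T(1)] by blast
  qed
  show ?thesis
  proof (intro set_eqI iffI)
    fix T assume T: "T \<in> rank_bounded_at \<beta> \<nu>"
    then have "T \<in> Tr" unfolding rank_bounded_at_def by blast
    show "T \<in> {T \<in> Tr. \<nu> \<notin> T} \<union> (Tr \<inter> (\<Inter>k. {T \<in> Tr. \<nu> @ [k] \<notin> T} \<union>
        (\<Union>\<gamma>\<in>underS W \<beta>. rank_bounded_at \<gamma> (\<nu> @ [k]))))"
    proof (cases "\<nu> \<in> T")
      case True
      then show ?thesis using rec[OF \<open>T \<in> Tr\<close> True] T \<open>T \<in> Tr\<close> by blast
    qed (use \<open>T \<in> Tr\<close> in blast)
  next
    fix T assume T: "T \<in> {T \<in> Tr. \<nu> \<notin> T} \<union> (Tr \<inter> (\<Inter>k. {T \<in> Tr. \<nu> @ [k] \<notin> T} \<union>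
        (\<Union>\<gamma>\<in>underS W \<beta>. rank_bounded_at \<gamma> (\<nu> @ [k]))))"
    then have "T \<in> Tr" by blast
    show "T \<in> rank_bounded_at \<beta> \<nu>"
    proof (cases "\<nu> \<in> T")
      case True
      then show ?thesis using rec[OF \<open>T \<in> Tr\<close> True] T by blast
    qed (use \<open>T \<in> Tr\<close> in \<open>simp add: rank_bounded_at_def\<close>)
  qed
qed

lemma A_eq_rank_bounded_at:
  assumes \<alpha>: "\<alpha> \<in> Field W"
  shows "A \<alpha> = (rank_bounded_at \<alpha> [] - {T \<in> Tr. [] \<notin> T}) - (\<Union>\<gamma>\<in>underS W \<alpha>. rank_bounded_at \<gamma> [])"
proof -
  have "\<rho> = \<alpha> \<longleftrightarrow> (\<rho>, \<alpha>) \<in> W \<and> (\<forall>\<gamma>\<in>underS W \<alpha>. (\<rho>, \<gamma>) \<notin> W)" if "\<rho> \<in> Field W" for \<rho>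
    using W_refl[OF that] W_not_le_iff[OF \<alpha> that] underS_W_le_trans[of \<alpha> _ \<alpha>]
    unfolding underS_def by blast
  then have "T \<in> A \<alpha> \<longleftrightarrow> T \<in> Trw \<and> [] \<in> T \<and> (rank_fun T [], \<alpha>) \<in> W \<and>
      (\<forall>\<gamma>\<in>underS W \<alpha>. (rank_fun T [], \<gamma>) \<notin> W)" for T
    using rank_fun_Field[of T "[]"] unfolding A_def by blast
  then show ?thesis unfolding rank_bounded_at_def using Trw_imp_Tr by auto
qed

definition char_fun :: "nat list set \<Rightarrow> nat list \<Rightarrow> bool" where
  "char_fun T = (\<lambda>s. s \<in> T)"

lemma inj_char_fun: "inj char_fun"
  unfolding char_fun_def inj_def by (metis mem_Collect_eq Collect_mem_eq)

lemma Borel_Tr_iff: "Borel_Tr B \<longleftrightarrow> B \<subseteq> Tr \<and> char_fun ` B \<in> sets borel"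
  unfolding Borel_Tr_def char_fun_def ..

lemma open_coordinate: "open {g :: nat list \<Rightarrow> bool. g s}"
proof -
  have "{g :: nat list \<Rightarrow> bool. g s} = (\<lambda>g. g s) -` {False<..}"
    by (auto simp: greaterThan_def less_bool_def)
  then show ?thesis
    using open_vimage[OF open_greaterThan continuous_on_product_coordinates] by metis
qed

lemma Borel_Tr_Tr: "Borel_Tr Tr"
proof -
  have "char_fun ` Tr = (\<Inter>s. \<Inter>n. (UNIV - {g :: nat list \<Rightarrow> bool. g s}) \<union> {g. g (take n s)})"
  proof (intro set_eqI iffI)
    fix g assume "g \<in> (\<Inter>s. \<Inter>n. (UNIV - {g :: nat list \<Rightarrow> bool. g s}) \<union> {g. g (take n s)})"
    then have "{s. g s} \<in> Tr" unfolding Tr_def by auto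
    moreover have "g = char_fun {s. g s}" unfolding char_fun_def by simp
    ultimately show "g \<in> char_fun ` Tr" by blast
  qed (auto simp: char_fun_def Tr_def)
  also have "\<dots> \<in> sets borel"
    by (intro sets.countable_INT'' sets.Un sets.Diff sets.top borel_open open_coordinate) auto
  finally show ?thesis unfolding Borel_Tr_iff by simp
qed

lemma Borel_Tr_Diff: "Borel_Tr B1 \<Longrightarrow> Borel_Tr B2 \<Longrightarrow> Borel_Tr (B1 - B2)"
  unfolding Borel_Tr_iff by (auto simp: image_set_diff[OF inj_char_fun])

lemma Borel_Tr_UN:
  "countable I \<Longrightarrow> (\<And>i. i \<in> I \<Longrightarrow> Borel_Tr (B i)) \<Longrightarrow> Borel_Tr (\<Union>i\<in>I. B i)"
  unfolding Borel_Tr_iff image_UN by (auto intro!: sets.countable_UN'')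

lemma Borel_Tr_Un: "Borel_Tr B1 \<Longrightarrow> Borel_Tr B2 \<Longrightarrow> Borel_Tr (B1 \<union> B2)"
  unfolding Borel_Tr_iff by (auto simp: image_Un)

lemma Borel_Tr_INT:
  assumes "countable I" "\<And>i. i \<in> I \<Longrightarrow> Borel_Tr (B i)"
  shows "Borel_Tr (Tr \<inter> (\<Inter>i\<in>I. B i))"
proof -
  have "Tr \<inter> (\<Inter>i\<in>I. B i) = Tr - (\<Union>i\<in>I. Tr - B i)" by blast
  moreover have "Borel_Tr (Tr - (\<Union>i\<in>I. Tr - B i))"
    by (intro Borel_Tr_Diff Borel_Tr_Tr Borel_Tr_UN assms)
  ultimately show ?thesis by simp
qed

lemma Borel_Tr_not_mem: "Borel_Tr {T \<in> Tr. s \<notin> T}"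
proof -
  have "char_fun ` {T \<in> Tr. s \<in> T} = char_fun ` Tr \<inter> {g. g s}" unfolding char_fun_def by auto
  then have "Borel_Tr {T \<in> Tr. s \<in> T}"
    using Borel_Tr_Tr borel_open[OF open_coordinate] unfolding Borel_Tr_iff by auto
  moreover have "{T \<in> Tr. s \<notin> T} = Tr - {T \<in> Tr. s \<in> T}" by blast
  ultimately show ?thesis using Borel_Tr_Diff[OF Borel_Tr_Tr] by simp
qed

lemma Borel_Tr_rank_bounded_at: "\<beta> \<in> Field W \<Longrightarrow> Borel_Tr (rank_bounded_at \<beta> \<nu>)"
proof (induction \<beta> arbitrary: \<nu> rule: wf_induct_rule[OF wf_W, case_names less])
  case (less \<beta>)
  have "Borel_Tr (rank_bounded_at \<gamma> \<mu>)" if "\<gamma> \<in> underS W \<beta>" for \<gamma> \<mu>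
    using less that unfolding underS_def by (blast intro: FieldI1)
  then show ?case
    unfolding rank_bounded_at_rec[OF less.prems]
    by (intro Borel_Tr_Un Borel_Tr_not_mem Borel_Tr_INT Borel_Tr_UN countable_underS_W) auto
qed

lemma Borel_Tr_A: "\<alpha> \<in> Field W \<Longrightarrow> Borel_Tr (A \<alpha>)"
  unfolding A_eq_rank_bounded_at
  by (intro Borel_Tr_Diff Borel_Tr_UN Borel_Tr_not_mem Borel_Tr_rank_bounded_at countable_underS_W)
    (auto simp: underS_def intro: FieldI1)

section \<open>The topologies tau\<close>

lemma box_mono: "n \<le> m \<Longrightarrow> box n \<subseteq> box m"
  unfolding box_def by auto

lemma take_mem_box: "s \<in> box n \<Longrightarrow> take k s \<in> box n"
  unfolding box_def by (auto dest: in_set_takeD)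

lemma mem_box_if_large: "length s + sum_list s < n \<Longrightarrow> s \<in> box n"
  unfolding box_def
proof (intro CollectI conjI ballI)
  assume "length s + sum_list s < n"
  moreover fix x assume "x \<in> set s"
  ultimately show "x < n" using member_le_sum_list[of x s] by simp
qed simp

lemma finite_box: "finite (box n)"
proof (rule finite_subset)
  show "box n \<subseteq> {s. set s \<subseteq> {..<n} \<and> length s \<le> n}" unfolding box_def by auto
qed (rule finite_lists_length_le, simp)

lemma U_subset_A: "U \<alpha> n T \<subseteq> A \<alpha>"
  unfolding U_def by blast

lemma mem_U_self: "T \<in> A \<alpha> \<Longrightarrow> T \<in> U \<alpha> n T"
  unfolding U_def by blast

lemma U_antimono:
  assumes y: "y \<in> U \<alpha> n T" and "n \<le> m"
  shows "U \<alpha> m y \<subseteq> U \<alpha> n T"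
proof
  fix T' assume T': "T' \<in> U \<alpha> m y"
  have nm: "box n \<subseteq> box m" using box_mono \<open>n \<le> m\<close> .
  have "T' \<inter> box n = T \<inter> box n"
  proof -
    have "T' \<inter> box n = (T' \<inter> box m) \<inter> box n" using nm by blast
    also have "\<dots> = y \<inter> box n" using T' nm unfolding U_def by blast
    also have "\<dots> = T \<inter> box n" using y unfolding U_def by blast
    finally show ?thesis .
  qed
  moreover have "rank_fun T' \<nu> = rank_fun T \<nu>" if "\<nu> \<in> T \<inter> box n" for \<nu>
  proof -
    have "\<nu> \<in> y \<inter> box m" using y that nm unfolding U_def by blast
    then show ?thesis using y T' that unfolding U_def by simp
  qed
  ultimately show "T' \<in> U \<alpha> n T" using T' unfolding U_def by blast
qed

lemma topspace_tau: "topspace (tau \<alpha>) = A \<alpha>"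
  unfolding tau_def topology_generated_by_topspace
proof
  show "\<Union> {U \<alpha> n T |n T. T \<in> A \<alpha>} \<subseteq> A \<alpha>" using U_subset_A by blast
  show "A \<alpha> \<subseteq> \<Union> {U \<alpha> n T |n T. T \<in> A \<alpha>}" using mem_U_self by blast
qed

lemma openin_tau_U: "T \<in> A \<alpha> \<Longrightarrow> openin (tau \<alpha>) (U \<alpha> n T)"
  unfolding tau_def by (rule topology_generated_by_Basis) blast

lemma openin_tau_imp_U_subset:
  assumes "openin (tau \<alpha>) V" "T \<in> V"
  shows "\<exists>n. U \<alpha> n T \<subseteq> V"
proof -
  have "generate_topology_on {U \<alpha> n T | n T. T \<in> A \<alpha>} V"
    using assms(1) unfolding tau_def openin_topology_generated_by_iff .
  moreover have "T \<in> A \<alpha>" using openin_subset[OF assms(1)] assms(2) topspace_tau by blast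
  ultimately show ?thesis using assms(2)
  proof (induction arbitrary: T rule: generate_topology_on.induct)
    case (Int a b)
    then obtain n1 n2 where "U \<alpha> n1 T \<subseteq> a" "U \<alpha> n2 T \<subseteq> b" by blast
    moreover have "U \<alpha> (max n1 n2) T \<subseteq> U \<alpha> n1 T" "U \<alpha> (max n1 n2) T \<subseteq> U \<alpha> n2 T"
      using U_antimono[OF mem_U_self[OF \<open>T \<in> A \<alpha>\<close>]] by simp_all
    ultimately show ?case by blast
  next
    case (UN K)
    then show ?case by blast
  next
    case (Basis s)
    then obtain n T' where s: "s = U \<alpha> n T'" by blast
    then have "U \<alpha> n T \<subseteq> U \<alpha> n T'"
      using U_antimono[of T \<alpha> n T' n] Basis.prems(2) by simp
    then show ?case using s by blast
  qed simp
qed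

lemma openin_tau_mem_eq: "openin (tau \<alpha>) {T \<in> A \<alpha>. (s \<in> T) = b}"
proof (subst openin_subopen, intro ballI)
  fix T assume T: "T \<in> {T \<in> A \<alpha>. (s \<in> T) = b}"
  define m where "m = length s + sum_list s + 1"
  have "s \<in> box m" unfolding m_def by (rule mem_box_if_large) simp
  have "U \<alpha> m T \<subseteq> {T \<in> A \<alpha>. (s \<in> T) = b}"
  proof
    fix T' assume T': "T' \<in> U \<alpha> m T"
    then have "T' \<inter> box m = T \<inter> box m" unfolding U_def by blast
    then have "(s \<in> T') = (s \<in> T)" using \<open>s \<in> box m\<close> by blast
    then show "T' \<in> {T \<in> A \<alpha>. (s \<in> T) = b}" using T T' U_subset_A by blast
  qed
  then show "\<exists>V. openin (tau \<alpha>) V \<and> T \<in> V \<and> V \<subseteq> {T \<in> A \<alpha>. (s \<in> T) = b}"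
    using openin_tau_U[of T \<alpha> m] mem_U_self[of T \<alpha> m] T by blast
qed

lemma continuous_map_char_fun: "continuous_map (tau \<alpha>) euclidean char_fun"
proof -
  have "continuous_map (tau \<alpha>) euclidean (\<lambda>T. char_fun T s)" for s
    unfolding continuous_map
  proof (intro conjI allI impI)
    fix B :: "bool set"
    have "{T \<in> topspace (tau \<alpha>). char_fun T s \<in> B} = (\<Union>b\<in>B. {T \<in> A \<alpha>. (s \<in> T) = b})"
      unfolding topspace_tau char_fun_def by (auto intro: bexI[of _ "s \<in> _"])
    then show "openin (tau \<alpha>) {T \<in> topspace (tau \<alpha>). char_fun T s \<in> B}"
      by (auto intro!: openin_Union openin_tau_mem_eq)
  qed simp
  then have "continuous_map (tau \<alpha>) (product_topology (\<lambda>_. euclidean) UNIV) char_fun"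
    unfolding continuous_map_componentwise_UNIV by blast
  then show ?thesis unfolding euclidean_product_topology .
qed

lemma countable_under_W: "countable (under W \<alpha>)"
proof -
  have "under W \<alpha> \<subseteq> insert \<alpha> (underS W \<alpha>)" unfolding under_def underS_def by auto
  then show ?thesis using countable_subset[OF _ countable_insert[OF countable_underS_W]] by simp
qed

text \<open>A basic open set \<open>U \<alpha> n T\<close> is determined by the finite set \<open>T \<inter> box n\<close> and the ranks,
  all at most \<open>\<alpha>\<close>, on it; hence \<open>tau \<alpha>\<close> is second countable.\<close>

definition tau_base :: "nat set \<Rightarrow> nat list set set set" where
  "tau_base \<alpha> = {U \<alpha> n T | n T. T \<in> A \<alpha>}"

lemma countable_tau_base: "countable (tau_base \<alpha>)"
proof -
  define C where "C = (SIGMA n:(UNIV :: nat set). SIGMA S:Pow (box n). Pi\<^sub>E S (\<lambda>_. under W \<alpha>))"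
  define g where "g = (\<lambda>(n, S, h). {T' \<in> A \<alpha>. T' \<inter> box n = S \<and> (\<forall>\<nu>\<in>S. rank_fun T' \<nu> = h \<nu>)})"
  have C: "countable C" unfolding C_def
  proof (intro countable_SIGMA countableI_type)
    fix n S assume "S \<in> Pow (box n)"
    then have "finite S" using finite_subset[OF _ finite_box] by blast
    then show "countable (Pi\<^sub>E S (\<lambda>_. under W \<alpha>))" using countable_under_W by (intro countable_PiE) auto
  qed (rule countable_finite, simp add: finite_box)
  have "tau_base \<alpha> \<subseteq> g ` C"
    unfolding tau_base_def
  proof clarify
    fix n T assume T: "T \<in> A \<alpha>"
    define h where "h = restrict (rank_fun T) (T \<inter> box n)"
    have "(rank_fun T \<nu>, \<alpha>) \<in> W" if "\<nu> \<in> T" for \<nu>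
      using T rank_fun_le_root[OF _ that] unfolding A_def by blast
    then have "h \<in> Pi\<^sub>E (T \<inter> box n) (\<lambda>_. under W \<alpha>)"
      unfolding h_def restrict_PiE_iff under_def by blast
    then have "(n, T \<inter> box n, h) \<in> C" unfolding C_def by auto
    moreover have "U \<alpha> n T = g (n, T \<inter> box n, h)" by (simp add: U_def g_def h_def)
    ultimately show "U \<alpha> n T \<in> g ` C" by blast
  qed
  then show ?thesis using countable_subset[OF _ countable_image[OF C]] by blast
qed

section \<open>The Baire category theorem for tau\<close>

lemma nowhere_dense_avoiding_U:
  assumes N: "nowhere_dense_in (tau \<alpha>) N" and x: "x \<in> A \<alpha>"
  obtains y m where "y \<in> U \<alpha> n x" "U \<alpha> m y \<inter> N = {}"
proof -
  let ?X = "tau \<alpha>"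
  have "\<not> U \<alpha> n x \<subseteq> ?X closure_of N"
  proof
    assume "U \<alpha> n x \<subseteq> ?X closure_of N"
    then have "U \<alpha> n x \<subseteq> ?X interior_of (?X closure_of N)"
      using interior_of_maximal openin_tau_U[OF x] by blast
    then show False using N mem_U_self[OF x] unfolding nowhere_dense_in_def by blast
  qed
  then obtain y where y: "y \<in> U \<alpha> n x" "y \<notin> ?X closure_of N" by blast
  have "openin ?X (topspace ?X - ?X closure_of N)" by (rule openin_diff) auto
  moreover have "y \<in> topspace ?X - ?X closure_of N" using y U_subset_A topspace_tau by blast
  ultimately obtain m where "U \<alpha> m y \<subseteq> topspace ?X - ?X closure_of N"
    using openin_tau_imp_U_subset by blast
  moreover have "N \<subseteq> ?X closure_of N"
    using N closure_of_subset unfolding nowhere_dense_in_def by blast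
  ultimately show ?thesis using that y(1) by blast
qed

text \<open>The witness child is recorded inside \<open>box m\<close>, so that all later trees of a fusion sequence
  keep it, with its rank.\<close>

lemma fusion_step:
  assumes N: "nowhere_dense_in (tau \<alpha>) N" and x: "x \<in> A \<alpha>"
  obtains y m where "n < m" "y \<in> U \<alpha> n x" "U \<alpha> m y \<inter> N = {}"
    "\<nu> \<in> x \<inter> box n \<Longrightarrow> \<gamma> \<in> underS W (rank_fun x \<nu>) \<Longrightarrow>
      \<exists>k. \<nu> @ [k] \<in> y \<inter> box m \<and> (\<gamma>, rank_fun y (\<nu> @ [k])) \<in> W"
proof -
  have x_Trw: "x \<in> Trw" using x unfolding A_def by blast
  obtain m1 where m1: "n < m1" "\<nu> \<in> x \<inter> box n \<Longrightarrow> \<gamma> \<in> underS W (rank_fun x \<nu>) \<Longrightarrow>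
      \<exists>k. \<nu> @ [k] \<in> x \<inter> box m1 \<and> (\<gamma>, rank_fun x (\<nu> @ [k])) \<in> W"
  proof (cases "\<nu> \<in> x \<inter> box n \<and> \<gamma> \<in> underS W (rank_fun x \<nu>)")
    case True
    then obtain k where k: "\<nu> @ [k] \<in> x" "(\<gamma>, rank_fun x (\<nu> @ [k])) \<in> W"
      using rank_fun_witness[OF x_Trw] by blast
    define m1 where "m1 = max (Suc n) (length (\<nu> @ [k]) + sum_list (\<nu> @ [k]) + 1)"
    have "\<nu> @ [k] \<in> box m1" unfolding m1_def by (rule mem_box_if_large) simp
    moreover have "n < m1" unfolding m1_def by simp
    ultimately show ?thesis using that k by blast
  next
    case False
    then show ?thesis using that[of "Suc n"] by blast
  qed
  obtain y m0 where y: "y \<in> U \<alpha> m1 x" "U \<alpha> m0 y \<inter> N = {}"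
    using nowhere_dense_avoiding_U[OF N x] .
  define m where "m = max m0 m1"
  have "y \<in> A \<alpha>" using y(1) U_subset_A by blast
  then have "U \<alpha> m y \<inter> N = {}" using U_antimono[OF mem_U_self, of y \<alpha> m0 m] y(2) unfolding m_def by auto
  moreover have "y \<in> U \<alpha> n x"
    using U_antimono[OF mem_U_self[OF x] less_imp_le[OF m1(1)]] y(1) by blast
  moreover have "\<exists>k. \<nu> @ [k] \<in> y \<inter> box m \<and> (\<gamma>, rank_fun y (\<nu> @ [k])) \<in> W"
    if req: "\<nu> \<in> x \<inter> box n" "\<gamma> \<in> underS W (rank_fun x \<nu>)"
  proof -
    obtain k where k: "\<nu> @ [k] \<in> x \<inter> box m1" "(\<gamma>, rank_fun x (\<nu> @ [k])) \<in> W"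
      using m1(2)[OF req] by blast
    then have "\<nu> @ [k] \<in> y \<inter> box m1" "rank_fun y (\<nu> @ [k]) = rank_fun x (\<nu> @ [k])"
      using y(1) unfolding U_def by auto
    moreover have "box m1 \<subseteq> box m" unfolding m_def by (rule box_mono) simp
    ultimately show ?thesis using k(2) by auto
  qed
  moreover have "n < m" using m1(1) unfolding m_def by simp
  ultimately show ?thesis using that by blast
qed

text \<open>The trees \<open>x i\<close> agree, ranks included, on ever larger boxes, so they converge to \<open>limit\<close>.\<close>

locale fusion_sequence =
  fixes \<alpha> :: "nat set" and x :: "nat \<Rightarrow> nat list set" and n :: "nat \<Rightarrow> nat"
  assumes x_0: "x 0 \<in> A \<alpha>"
    and x_Suc: "\<And>i. x (Suc i) \<in> U \<alpha> (n i) (x i)"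
    and n_less: "\<And>i. n i < n (Suc i)"
begin

lemma n_mono: "i \<le> j \<Longrightarrow> n i \<le> n j"
  using lift_Suc_mono_le[of n] n_less less_imp_le by metis

lemma n_ge: "i \<le> n i"
proof (induction i)
  case (Suc i)
  then show ?case using n_less[of i] by simp
qed simp

lemma x_in_U: "i \<le> j \<Longrightarrow> x j \<in> U \<alpha> (n i) (x i)"
proof (induction j rule: dec_induct)
  case base
  show ?case
  proof (cases i)
    case 0
    then show ?thesis using mem_U_self[OF x_0] by simp
  next
    case (Suc i')
    then show ?thesis using mem_U_self x_Suc[of i'] U_subset_A by blast
  qed
next
  case (step j)
  then show ?case using U_antimono[OF step.IH n_mono[OF step.hyps(1)]] x_Suc[of j] by blast
qed

lemma x_A: "x i \<in> A \<alpha>"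
  using x_in_U[of i i] U_subset_A by blast

lemma x_Trw: "x i \<in> Trw"
  using x_A unfolding A_def by blast

lemma x_Int_box: "i \<le> j \<Longrightarrow> x j \<inter> box (n i) = x i \<inter> box (n i)"
  using x_in_U unfolding U_def by blast

lemma rank_x_eq: "i \<le> j \<Longrightarrow> \<nu> \<in> x i \<inter> box (n i) \<Longrightarrow> rank_fun (x j) \<nu> = rank_fun (x i) \<nu>"
  using x_in_U unfolding U_def by blast

definition limit :: "nat list set" where
  "limit = (\<Union>i. x i \<inter> box (n i))"

lemma limit_Int_box: "limit \<inter> box (n i) = x i \<inter> box (n i)"
proof -
  have "x j \<inter> box (n j) \<inter> box (n i) \<subseteq> x i" for j
  proof (cases "i \<le> j")
    case True
    then show ?thesis using x_Int_box[OF True] box_mono[OF n_mono[OF True]] by blast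
  next
    case False
    then show ?thesis using x_Int_box[of j i] by auto
  qed
  then show ?thesis unfolding limit_def by blast
qed

definition box_index :: "nat list \<Rightarrow> nat" where
  "box_index \<nu> = length \<nu> + sum_list \<nu> + 1"

lemma mem_box_n: "box_index \<nu> \<le> i \<Longrightarrow> \<nu> \<in> box (n i)"
  using mem_box_if_large[of \<nu> "n i"] n_ge[of i] unfolding box_index_def by simp

definition limit_rank :: "nat list \<Rightarrow> nat set" where
  "limit_rank \<nu> = rank_fun (x (box_index \<nu>)) \<nu>"

lemma limit_rank_eq:
  assumes "\<nu> \<in> limit" "\<nu> \<in> box (n i)"
  shows "\<nu> \<in> x i" "rank_fun (x i) \<nu> = limit_rank \<nu>"
proof -
  define j where "j = box_index \<nu>"
  have i: "\<nu> \<in> x i \<inter> box (n i)" and j: "\<nu> \<in> x j \<inter> box (n j)"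
    using assms limit_Int_box mem_box_n[of \<nu> j] unfolding j_def by blast+
  then show "\<nu> \<in> x i" by blast
  show "rank_fun (x i) \<nu> = limit_rank \<nu>"
    using rank_x_eq[OF _ i, of j] rank_x_eq[OF _ j, of i] unfolding limit_rank_def j_def
    by (cases "i \<le> box_index \<nu>") auto
qed

lemma limit_Tr: "limit \<in> Tr"
  unfolding Tr_def
proof (intro CollectI ballI allI)
  fix s k assume "s \<in> limit"
  then obtain i where "s \<in> x i" "s \<in> box (n i)" unfolding limit_def by blast
  then have "take k s \<in> x i \<inter> box (n i)"
    using Tr_take[OF Trw_imp_Tr[OF x_Trw]] take_mem_box by blast
  then show "take k s \<in> limit" unfolding limit_def by blast
qed

lemma limit_rank_Field: "\<nu> \<in> limit \<Longrightarrow> limit_rank \<nu> \<in> Field W"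
  using limit_rank_eq[OF _ mem_box_n[OF order_refl]] rank_fun_Field[OF x_Trw] by metis

lemma limit_rank_le: "\<nu> \<in> limit \<Longrightarrow> (limit_rank \<nu>, \<alpha>) \<in> W"
  using limit_rank_eq[OF _ mem_box_n[OF order_refl]] rank_fun_le_root[OF x_Trw] x_A
  unfolding A_def by force

lemma limit_rank_child:
  assumes "\<nu> @ [k] \<in> limit"
  shows "limit_rank (\<nu> @ [k]) \<in> underS W (limit_rank \<nu>)"
proof -
  define i where "i = box_index (\<nu> @ [k])"
  have "\<nu> @ [k] \<in> box (n i)" unfolding i_def by (rule mem_box_n) simp
  moreover have "\<nu> \<in> limit" using Tr_prefix[OF limit_Tr assms] .
  moreover have "\<nu> \<in> box (n i)" using take_mem_box[OF \<open>\<nu> @ [k] \<in> box (n i)\<close>, of "length \<nu>"] by simp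
  ultimately show ?thesis
    using limit_rank_eq[OF assms] limit_rank_eq[of \<nu> i] rank_fun_child[OF x_Trw[of i], of \<nu> k] by metis
qed

end

text \<open>To make the rank of the limit exactly \<open>\<alpha>\<close>, the sequence must infinitely often realise every
  requirement "below \<open>\<nu>\<close> there is a child of rank at least \<open>\<gamma>\<close>".\<close>

locale rank_fusion_sequence = fusion_sequence +
  assumes requirements: "\<And>\<nu> \<gamma> i0. \<gamma> \<in> underS W \<alpha> \<Longrightarrow> \<exists>i\<ge>i0.
    \<nu> \<in> x i \<inter> box (n i) \<and> \<gamma> \<in> underS W (rank_fun (x i) \<nu>) \<longrightarrow>
    (\<exists>k. \<nu> @ [k] \<in> x (Suc i) \<inter> box (n (Suc i)) \<and> (\<gamma>, rank_fun (x (Suc i)) (\<nu> @ [k])) \<in> W)"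
begin

lemma limit_rank_witness:
  assumes \<nu>: "\<nu> \<in> limit" and \<gamma>: "\<gamma> \<in> underS W (limit_rank \<nu>)"
  shows "\<exists>k. \<nu> @ [k] \<in> limit \<and> (\<gamma>, limit_rank (\<nu> @ [k])) \<in> W"
proof -
  have "\<gamma> \<in> underS W \<alpha>" using underS_W_le_trans[OF \<gamma> limit_rank_le[OF \<nu>]] .
  then obtain i where "box_index \<nu> \<le> i" and i: "\<nu> \<in> x i \<inter> box (n i) \<and> \<gamma> \<in> underS W (rank_fun (x i) \<nu>) \<longrightarrow>
    (\<exists>k. \<nu> @ [k] \<in> x (Suc i) \<inter> box (n (Suc i)) \<and> (\<gamma>, rank_fun (x (Suc i)) (\<nu> @ [k])) \<in> W)"
    using requirements by blast
  then have "\<nu> \<in> box (n i)" using mem_box_n by blast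
  then obtain k where k: "\<nu> @ [k] \<in> x (Suc i) \<inter> box (n (Suc i))"
      "(\<gamma>, rank_fun (x (Suc i)) (\<nu> @ [k])) \<in> W"
    using i limit_rank_eq[OF \<nu>] \<gamma> by auto
  then have "\<nu> @ [k] \<in> limit" unfolding limit_def by blast
  then show ?thesis using k limit_rank_eq[of "\<nu> @ [k]" "Suc i"] by auto
qed

lemma is_rank_limit: "is_rank limit limit_rank"
  unfolding is_rank_iff using limit_rank_Field limit_rank_child limit_rank_witness by blast

lemma limit_in_U: "limit \<in> U \<alpha> (n i) (x i)"
proof -
  have Nil: "[] \<in> limit" "[] \<in> box (n 0)"
    using x_A[of 0] limit_Int_box[of 0] unfolding A_def box_def by auto
  have "limit \<in> Trw" using is_rank_imp_Trw[OF limit_Tr is_rank_limit] .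
  moreover have "rank_fun limit \<nu> = rank_fun (x i) \<nu>" if "\<nu> \<in> x i \<inter> box (n i)" for \<nu>
    using that limit_Int_box rank_fun_eqI[OF limit_Tr is_rank_limit] limit_rank_eq by blast
  moreover have "rank_fun limit [] = \<alpha>"
    using Nil x_A[of 0] rank_fun_eqI[OF limit_Tr is_rank_limit] limit_rank_eq
    unfolding A_def by auto
  ultimately show ?thesis using limit_Int_box Nil(1) unfolding U_def A_def by blast
qed

end

lemma enumerate_requirements:
  obtains r :: "nat \<Rightarrow> nat list \<times> nat set"
  where "\<And>\<nu> \<gamma> i0. \<gamma> \<in> underS W \<alpha> \<Longrightarrow> \<exists>i\<ge>i0. r i = (\<nu>, \<gamma>)"
proof
  define R where "R = (UNIV :: nat list set) \<times> underS W \<alpha>"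
  have "countable R" unfolding R_def by (intro countable_SIGMA countableI_type countable_underS_W)
  fix \<nu> \<gamma> i0 assume "\<gamma> \<in> underS W \<alpha>"
  then obtain j where "from_nat_into R j = (\<nu>, \<gamma>)"
    using from_nat_into_surj[OF \<open>countable R\<close>] unfolding R_def by blast
  then show "\<exists>i\<ge>i0. from_nat_into R (fst (prod_decode i)) = (\<nu>, \<gamma>)"
    by (intro exI[of _ "prod_encode (j, i0)"]) (simp add: le_prod_encode_2)
qed

lemma exists_rank_fusion_sequence:
  assumes x0: "x0 \<in> A \<alpha>" and N: "\<And>i. nowhere_dense_in (tau \<alpha>) (N i)"
  obtains x n where "rank_fusion_sequence \<alpha> x n" "x 0 = x0" "n 0 = n0"
    "\<And>i. U \<alpha> (n (Suc i)) (x (Suc i)) \<inter> N i = {}"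
proof -
  obtain r :: "nat \<Rightarrow> nat list \<times> nat set"
    where r: "\<And>\<nu> \<gamma> i0. \<gamma> \<in> underS W \<alpha> \<Longrightarrow> \<exists>i\<ge>i0. r i = (\<nu>, \<gamma>)"
    using enumerate_requirements by blast
  define step where "step i p q \<longleftrightarrow> snd p < snd q \<and> fst q \<in> U \<alpha> (snd p) (fst p)
    \<and> U \<alpha> (snd q) (fst q) \<inter> N i = {}
    \<and> (fst (r i) \<in> fst p \<inter> box (snd p) \<and> snd (r i) \<in> underS W (rank_fun (fst p) (fst (r i))) \<longrightarrow>
      (\<exists>k. fst (r i) @ [k] \<in> fst q \<inter> box (snd q) \<and> (snd (r i), rank_fun (fst q) (fst (r i) @ [k])) \<in> W))"
    for i p q
  have step_ex: "\<exists>q. step i p q" if p: "fst p \<in> A \<alpha>" for i p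
  proof (rule fusion_step[OF N p, where n="snd p" and \<nu>="fst (r i)" and \<gamma>="snd (r i)"])
    fix y m
    assume "snd p < m" "y \<in> U \<alpha> (snd p) (fst p)" "U \<alpha> m y \<inter> N i = {}"
      "fst (r i) \<in> fst p \<inter> box (snd p) \<Longrightarrow> snd (r i) \<in> underS W (rank_fun (fst p) (fst (r i))) \<Longrightarrow>
        \<exists>k. fst (r i) @ [k] \<in> y \<inter> box m \<and> (snd (r i), rank_fun y (fst (r i) @ [k])) \<in> W"
    then have "step i p (y, m)" unfolding step_def fst_conv snd_conv by blast
    then show ?thesis by blast
  qed
  have "\<exists>seq. \<forall>i. (fst (seq i) \<in> A \<alpha> \<and> (i = 0 \<longrightarrow> seq i = (x0, n0))) \<and> step i (seq i) (seq (Suc i))"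
  proof (rule dependent_nat_choice)
    fix p and i :: nat assume "fst p \<in> A \<alpha> \<and> (i = 0 \<longrightarrow> p = (x0, n0))"
    then obtain q where "step i p q" using step_ex by blast
    moreover have "fst q \<in> A \<alpha>" using \<open>step i p q\<close> U_subset_A unfolding step_def by blast
    ultimately show "\<exists>q. (fst q \<in> A \<alpha> \<and> (Suc i = 0 \<longrightarrow> q = (x0, n0))) \<and> step i p q" by blast
  qed (use x0 in auto)
  then obtain seq where A: "\<And>i. fst (seq i) \<in> A \<alpha>" and seq0: "seq 0 = (x0, n0)"
    and step: "\<And>i. step i (seq i) (seq (Suc i))"
    by blast
  interpret fusion_sequence \<alpha> "\<lambda>i. fst (seq i)" "\<lambda>i. snd (seq i)"
    using A step unfolding step_def by unfold_locales blast+
  have "rank_fusion_sequence \<alpha> (\<lambda>i. fst (seq i)) (\<lambda>i. snd (seq i))"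
  proof unfold_locales
    fix \<nu> \<gamma> i0 assume "\<gamma> \<in> underS W \<alpha>"
    then obtain i where "i \<ge> i0" "r i = (\<nu>, \<gamma>)" using r by blast
    then show "\<exists>i\<ge>i0. \<nu> \<in> fst (seq i) \<inter> box (snd (seq i)) \<and>
        \<gamma> \<in> underS W (rank_fun (fst (seq i)) \<nu>) \<longrightarrow>
        (\<exists>k. \<nu> @ [k] \<in> fst (seq (Suc i)) \<inter> box (snd (seq (Suc i))) \<and>
          (\<gamma>, rank_fun (fst (seq (Suc i))) (\<nu> @ [k])) \<in> W)"
      using step[of i] unfolding step_def by auto
  qed
  then show ?thesis using that seq0 step unfolding step_def by simp
qed

theorem tau_Baire:
  assumes V: "openin (tau \<alpha>) V" "V \<noteq> {}"
  shows "\<not> meager_in (tau \<alpha>) V"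
proof
  assume "meager_in (tau \<alpha>) V"
  then obtain F where F: "countable F" "\<And>N. N \<in> F \<Longrightarrow> nowhere_dense_in (tau \<alpha>) N" "V \<subseteq> \<Union>F"
    unfolding meager_in_def by blast
  have "F \<noteq> {}" using F(3) V(2) by auto
  define N where "N = from_nat_into F"
  have range_N: "range N = F" unfolding N_def using range_from_nat_into[OF \<open>F \<noteq> {}\<close> F(1)] .
  obtain x0 where "x0 \<in> V" using V(2) by blast
  then obtain n0 where n0: "U \<alpha> n0 x0 \<subseteq> V" using openin_tau_imp_U_subset[OF V(1)] by blast
  have "x0 \<in> A \<alpha>" using openin_subset[OF V(1)] \<open>x0 \<in> V\<close> topspace_tau by blast
  moreover have "nowhere_dense_in (tau \<alpha>) (N i)" for i using F(2) range_N by blast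
  ultimately obtain x n where seq: "rank_fusion_sequence \<alpha> x n" "x 0 = x0" "n 0 = n0"
      and avoid: "\<And>i. U \<alpha> (n (Suc i)) (x (Suc i)) \<inter> N i = {}"
    using exists_rank_fusion_sequence by metis
  interpret rank_fusion_sequence \<alpha> x n by (rule seq(1))
  have "limit \<in> V" using limit_in_U[of 0] seq n0 by auto
  moreover have "limit \<notin> N i" for i using limit_in_U[of "Suc i"] avoid[of i] by blast
  ultimately show False using F(3) range_N by blast
qed

section \<open>Meager sets and the Baire property\<close>

lemma meager_in_subset: "meager_in X S \<Longrightarrow> T \<subseteq> S \<Longrightarrow> meager_in X T"
proof -
  assume m: "meager_in X S" and TS: "T \<subseteq> S"
  obtain F where F: "countable F" "\<forall>N\<in>F. nowhere_dense_in X N" "S \<subseteq> \<Union>F"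
    using m unfolding meager_in_def by (elim exE conjE) (intro that)
  have "T \<subseteq> \<Union>F" by (rule order_trans[OF TS F(3)])
  then show ?thesis unfolding meager_in_def using F(1,2) by (intro exI[of _ F] conjI)
qed

lemma meager_in_empty: "meager_in X {}"
  unfolding meager_in_def by (intro exI[of _ "{}"]) simp

lemma nowhere_dense_imp_meager_in: "nowhere_dense_in X N \<Longrightarrow> meager_in X N"
  unfolding meager_in_def by (intro exI[of _ "{N}"]) simp

lemma meager_in_Union:
  assumes "countable F" "\<And>S. S \<in> F \<Longrightarrow> meager_in X S"
  shows "meager_in X (\<Union>F)"
proof -
  have "\<forall>S\<in>F. \<exists>G. countable G \<and> (\<forall>N\<in>G. nowhere_dense_in X N) \<and> S \<subseteq> \<Union>G"
    using assms(2) unfolding meager_in_def by (intro ballI) simp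
  then obtain G where G: "\<And>S. S \<in> F \<Longrightarrow> countable (G S) \<and> (\<forall>N\<in>G S. nowhere_dense_in X N) \<and> S \<subseteq> \<Union>(G S)"
    by (metis (no_types))
  have c: "countable (\<Union>S\<in>F. G S)" using assms(1) G by (intro countable_UN) simp_all
  have n: "\<forall>N\<in>(\<Union>S\<in>F. G S). nowhere_dense_in X N"
  proof
    fix N assume "N \<in> (\<Union>S\<in>F. G S)"
    then obtain S where "S \<in> F" "N \<in> G S" by (elim UN_E)
    then show "nowhere_dense_in X N" using G by simp
  qed
  have u: "\<Union>F \<subseteq> \<Union>(\<Union>S\<in>F. G S)"
  proof
    fix x assume "x \<in> \<Union>F"
    then obtain S where S: "S \<in> F" "x \<in> S" by (elim UnionE)
    have "S \<subseteq> \<Union>(G S)" using G[OF S(1)] by (elim conjE)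
    then have "x \<in> \<Union>(G S)" using S(2) by (rule subsetD)
    then show "x \<in> \<Union>(\<Union>S\<in>F. G S)" using S(1) by auto
  qed
  show ?thesis unfolding meager_in_def using c n u by (intro exI[of _ "\<Union>S\<in>F. G S"] conjI)
qed

lemma meager_in_Un: "meager_in X S \<Longrightarrow> meager_in X T \<Longrightarrow> meager_in X (S \<union> T)"
proof -
  assume a: "meager_in X S" "meager_in X T"
  have "meager_in X (\<Union>{S, T})" by (rule meager_in_Union) (use a in auto)
  then show ?thesis by simp
qed

lemma nowhere_dense_closure_of_diff:
  assumes V: "openin X V"
  shows "nowhere_dense_in X (X closure_of V - V)"
proof -
  let ?F = "X closure_of V - V"
  have cl: "closedin X ?F" by (intro closedin_diff closedin_closure_of V)
  have "X interior_of ?F = {}"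
  proof -
    let ?I = "X interior_of ?F"
    have oI: "openin X ?I" by simp
    have sI: "?I \<subseteq> ?F" by (rule interior_of_subset)
    then have "?I \<inter> V = {}" by blast
    then have "?I \<inter> X closure_of V = {}" using openin_Int_closure_of_eq_empty[OF oI] by blast
    then show ?thesis using sI by blast
  qed
  moreover have "?F \<subseteq> topspace X" by (rule order_trans[OF Diff_subset closure_of_subset_topspace])
  ultimately show ?thesis unfolding nowhere_dense_in_def closure_of_closedin[OF cl] by simp
qed

definition baire_property :: "'a topology \<Rightarrow> 'a set \<Rightarrow> bool" where
  "baire_property X S \<longleftrightarrow> (\<exists>V. openin X V \<and> meager_in X ((S - V) \<union> (V - S)))"

lemma baire_property_open: "openin X V \<Longrightarrow> baire_property X V"
  unfolding baire_property_def using meager_in_empty by (intro exI[of _ V]) simp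

lemma baire_property_complement:
  assumes "baire_property X S"
  shows "baire_property X (topspace X - S)"
proof -
  obtain V where V: "openin X V" "meager_in X ((S - V) \<union> (V - S))" using assms unfolding baire_property_def by blast
  let ?V' = "topspace X - X closure_of V"
  have o: "openin X ?V'" by (rule openin_diff) auto
  have Vt: "V \<subseteq> X closure_of V" using closure_of_subset[OF openin_subset[OF V(1)]] .
  have ct: "X closure_of V \<subseteq> topspace X" by (rule closure_of_subset_topspace)
  have sub: "((topspace X - S) - ?V') \<union> (?V' - (topspace X - S)) \<subseteq> ((S - V) \<union> (V - S)) \<union> (X closure_of V - V)"
  proof (rule subsetI)
    fix x assume x: "x \<in> ((topspace X - S) - ?V') \<union> (?V' - (topspace X - S))"
    show "x \<in> ((S - V) \<union> (V - S)) \<union> (X closure_of V - V)"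
    proof (cases "x \<in> V")
      case True then show ?thesis using x Vt by auto
    next
      case False then show ?thesis using x by auto
    qed
  qed
  have m: "meager_in X (((S - V) \<union> (V - S)) \<union> (X closure_of V - V))"
    by (rule meager_in_Un[OF V(2) nowhere_dense_imp_meager_in[OF nowhere_dense_closure_of_diff[OF V(1)]]])
  have "meager_in X (((topspace X - S) - ?V') \<union> (?V' - (topspace X - S)))"
    by (rule meager_in_subset[OF m sub])
  then show ?thesis unfolding baire_property_def using o by (intro exI[of _ ?V'] conjI)
qed

lemma baire_property_Union:
  assumes "countable F" "\<And>S. S \<in> F \<Longrightarrow> baire_property X S"
  shows "baire_property X (\<Union>F)"
proof -
  have "\<forall>S\<in>F. \<exists>V. openin X V \<and> meager_in X ((S - V) \<union> (V - S))"
    using assms(2) unfolding baire_property_def by blast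
  then obtain V where V: "\<And>S. S \<in> F \<Longrightarrow> openin X (V S) \<and> meager_in X ((S - V S) \<union> (V S - S))"
    by metis
  have o: "openin X (\<Union>S\<in>F. V S)" using V by blast
  have sub: "((\<Union>F) - (\<Union>S\<in>F. V S)) \<union> ((\<Union>S\<in>F. V S) - \<Union>F) \<subseteq> \<Union>((\<lambda>S. (S - V S) \<union> (V S - S)) ` F)"
    by blast
  have m: "meager_in X (\<Union>((\<lambda>S. (S - V S) \<union> (V S - S)) ` F))"
    using V assms(1) by (intro meager_in_Union) auto
  have "meager_in X (((\<Union>F) - (\<Union>S\<in>F. V S)) \<union> ((\<Union>S\<in>F. V S) - \<Union>F))"
    by (rule meager_in_subset[OF m sub])
  then show ?thesis unfolding baire_property_def using o by (intro exI[of _ "\<Union>S\<in>F. V S"] conjI)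
qed

lemma baire_property_empty: "baire_property X {}"
  by (rule baire_property_open) simp

lemma baire_property_borel_preimage:
  fixes f :: "'a \<Rightarrow> 'b::topological_space"
  assumes f: "continuous_map X euclidean f" and Y: "Y \<in> sets borel"
  shows "baire_property X (f -` Y \<inter> topspace X)"
proof -
  have "Y \<in> sigma_sets UNIV {S. open S}" using Y sets_borel by metis
  then show ?thesis
  proof (induction rule: sigma_sets.induct)
    case (Basic a)
    then have "openin X {x \<in> topspace X. f x \<in> a}" using f unfolding continuous_map by simp
    moreover have "{x \<in> topspace X. f x \<in> a} = f -` a \<inter> topspace X" by blast
    ultimately show ?case using baire_property_open by metis
  next
    case Empty
    then show ?case using baire_property_empty by simp
  next
    case (Compl a)
    have "f -` (UNIV - a) \<inter> topspace X = topspace X - (f -` a \<inter> topspace X)" by blast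
    then show ?case using baire_property_complement[OF Compl.IH] by simp
  next
    case (Union a)
    have "f -` (\<Union>i. a i) \<inter> topspace X = \<Union>(range (\<lambda>i. f -` a i \<inter> topspace X))" by blast
    moreover have "baire_property X (\<Union>(range (\<lambda>i. f -` a i \<inter> topspace X)))"
      using Union.IH by (intro baire_property_Union) auto
    ultimately show ?case by simp
  qed
qed

lemma Borel_Tr_baire_property: "Borel_Tr B \<Longrightarrow> baire_property (tau \<alpha>) (B \<inter> A \<alpha>)"
  using baire_property_borel_preimage[OF continuous_map_char_fun, of "char_fun ` B" \<alpha>]
  unfolding Borel_Tr_iff inj_vimage_image_eq[OF inj_char_fun] topspace_tau by simp

section \<open>The ideal Istar\<close>

lemma IstarI:
  "Borel_Tr B \<Longrightarrow> S \<subseteq> B \<Longrightarrow> (\<And>\<alpha>. \<alpha> \<in> Field W \<Longrightarrow> \<alpha> \<noteq> ord_zero \<Longrightarrow> meager_in (tau \<alpha>) (B \<inter> A \<alpha>))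
    \<Longrightarrow> S \<in> Istar"
  unfolding Istar_def by blast

lemma IstarE:
  assumes "S \<in> Istar"
  obtains B where "Borel_Tr B" "S \<subseteq> B"
    "\<And>\<alpha>. \<alpha> \<in> Field W \<Longrightarrow> \<alpha> \<noteq> ord_zero \<Longrightarrow> meager_in (tau \<alpha>) (B \<inter> A \<alpha>)"
  using assms unfolding Istar_def by blast

lemma Istar_subset_Tr: "S \<in> Istar \<Longrightarrow> S \<subseteq> Tr"
  by (erule IstarE) (auto simp: Borel_Tr_def)

lemma Istar_subset: "S \<in> Istar \<Longrightarrow> S' \<subseteq> S \<Longrightarrow> S' \<in> Istar"
  by (erule IstarE) (blast intro: IstarI)

lemma Istar_Borel_hull: "S \<in> Istar \<Longrightarrow> \<exists>B. Borel_Tr B \<and> S \<subseteq> B \<and> B \<in> Istar"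
  by (erule IstarE) (blast intro: IstarI)

lemma Istar_countable_Union:
  assumes F: "countable F" "F \<subseteq> Istar"
  shows "\<Union>F \<in> Istar"
proof -
  have "\<forall>S\<in>F. \<exists>B. Borel_Tr B \<and> S \<subseteq> B \<and>
      (\<forall>\<alpha>. \<alpha> \<in> Field W \<longrightarrow> \<alpha> \<noteq> ord_zero \<longrightarrow> meager_in (tau \<alpha>) (B \<inter> A \<alpha>))"
  proof
    fix S assume "S \<in> F"
    then have "S \<in> Istar" using F(2) by blast
    then obtain B where "Borel_Tr B" "S \<subseteq> B"
      "\<And>\<alpha>. \<alpha> \<in> Field W \<Longrightarrow> \<alpha> \<noteq> ord_zero \<Longrightarrow> meager_in (tau \<alpha>) (B \<inter> A \<alpha>)"
      by (rule IstarE; blast)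
    then show "\<exists>B. Borel_Tr B \<and> S \<subseteq> B \<and>
        (\<forall>\<alpha>. \<alpha> \<in> Field W \<longrightarrow> \<alpha> \<noteq> ord_zero \<longrightarrow> meager_in (tau \<alpha>) (B \<inter> A \<alpha>))"
      by blast
  qed
  then obtain B where B: "\<And>S. S \<in> F \<Longrightarrow> Borel_Tr (B S) \<and> S \<subseteq> B S \<and>
      (\<forall>\<alpha>. \<alpha> \<in> Field W \<longrightarrow> \<alpha> \<noteq> ord_zero \<longrightarrow> meager_in (tau \<alpha>) (B S \<inter> A \<alpha>))"
    by metis
  show ?thesis
  proof (rule IstarI)
    show "Borel_Tr (\<Union>S\<in>F. B S)" using F(1) B by (intro Borel_Tr_UN) auto
    show "\<Union>F \<subseteq> (\<Union>S\<in>F. B S)" using B by blast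
    fix \<alpha> assume \<alpha>: "\<alpha> \<in> Field W" "\<alpha> \<noteq> ord_zero"
    have "(\<Union>S\<in>F. B S) \<inter> A \<alpha> = (\<Union>S\<in>F. B S \<inter> A \<alpha>)" by blast
    also have "meager_in (tau \<alpha>) \<dots>"
    proof (rule meager_in_Union)
      show "countable ((\<lambda>S. B S \<inter> A \<alpha>) ` F)" using F(1) by simp
      fix M assume "M \<in> (\<lambda>S. B S \<inter> A \<alpha>) ` F"
      then show "meager_in (tau \<alpha>) M" using B \<alpha> by blast
    qed
    finally show "meager_in (tau \<alpha>) ((\<Union>S\<in>F. B S) \<inter> A \<alpha>)" .
  qed
qed

lemma Istar_imp_meager:
  assumes "S \<in> Istar" "\<alpha> \<in> Field W" "\<alpha> \<noteq> ord_zero"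
  shows "meager_in (tau \<alpha>) (S \<inter> A \<alpha>)"
proof -
  obtain B where "S \<subseteq> B" "meager_in (tau \<alpha>) (B \<inter> A \<alpha>)"
    using assms by (elim IstarE) blast
  then show ?thesis using meager_in_subset by blast
qed

lemma A_notin_Istar:
  assumes "\<alpha> \<in> Field W" "\<alpha> \<noteq> ord_zero"
  shows "A \<alpha> \<notin> Istar"
proof
  assume "A \<alpha> \<in> Istar"
  then have "meager_in (tau \<alpha>) (A \<alpha>)" using Istar_imp_meager[OF _ assms] by fastforce
  moreover have "openin (tau \<alpha>) (A \<alpha>)" using openin_topspace[of "tau \<alpha>"] unfolding topspace_tau .
  ultimately show False using tau_Baire A_nonempty[OF assms(1)] by blast
qed

lemma Tr_notin_Istar: "Tr \<notin> Istar"
proof -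
  have "infinite (Field W - {ord_zero})" using infinite_Field_W by simp
  then have "Field W - {ord_zero} \<noteq> {}" by (metis finite.emptyI)
  then obtain \<alpha> where "\<alpha> \<in> Field W" "\<alpha> \<noteq> ord_zero" by blast
  moreover have "A \<alpha> \<subseteq> Tr" unfolding A_def using Trw_imp_Tr by blast
  ultimately show ?thesis using A_notin_Istar Istar_subset by blast
qed

lemma A_disjoint: "\<alpha> \<noteq> \<beta> \<Longrightarrow> A \<alpha> \<inter> A \<beta> = {}"
proof -
  have "\<alpha> = \<beta>" if "T \<in> A \<alpha>" "T \<in> A \<beta>" for T
  proof -
    have "rank_fun T [] = \<alpha>" "rank_fun T [] = \<beta>" using that unfolding A_def by auto
    then show ?thesis by simp
  qed
  then show "\<alpha> \<noteq> \<beta> \<Longrightarrow> A \<alpha> \<inter> A \<beta> = {}" by blast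
qed

lemma Istar_not_ccc:
  "\<exists>F. (\<forall>B\<in>F. Borel_Tr B \<and> B \<notin> Istar) \<and> (\<forall>B1\<in>F. \<forall>B2\<in>F. B1 \<noteq> B2 \<longrightarrow> B1 \<inter> B2 = {})
    \<and> uncountable F"
proof (intro exI conjI)
  let ?F = "A ` (Field W - {ord_zero})"
  show "\<forall>B\<in>?F. Borel_Tr B \<and> B \<notin> Istar"
  proof
    fix B assume "B \<in> ?F"
    then obtain \<alpha> where "\<alpha> \<in> Field W" "\<alpha> \<noteq> ord_zero" "B = A \<alpha>" by blast
    then show "Borel_Tr B \<and> B \<notin> Istar" using Borel_Tr_A A_notin_Istar by simp
  qed
  show "\<forall>B1\<in>?F. \<forall>B2\<in>?F. B1 \<noteq> B2 \<longrightarrow> B1 \<inter> B2 = {}"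
    using A_disjoint by (metis (no_types, lifting) imageE)
  have "inj_on A (Field W - {ord_zero})"
  proof (rule inj_onI, rule ccontr)
    fix \<alpha> \<beta> assume "\<alpha> \<in> Field W - {ord_zero}" "A \<alpha> = A \<beta>" "\<alpha> \<noteq> \<beta>"
    then show False using A_disjoint[of \<alpha> \<beta>] A_nonempty[of \<alpha>] by simp
  qed
  moreover have "uncountable (Field W - {ord_zero})" using uncountable_Field_W by simp
  ultimately show "uncountable ?F" using countable_image_inj_on by blast
qed

lemma Borel_notin_Istar_imp_comeager_in_base:
  assumes B: "Borel_Tr B" "B \<notin> Istar"
  shows "\<exists>\<alpha>\<in>Field W - {ord_zero}. \<exists>V\<in>tau_base \<alpha>. meager_in (tau \<alpha>) (V - B)"
proof -
  have "\<not> (\<forall>\<alpha>\<in>Field W. \<alpha> \<noteq> ord_zero \<longrightarrow> meager_in (tau \<alpha>) (B \<inter> A \<alpha>))"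
    using B unfolding Istar_def by blast
  then obtain \<alpha> where \<alpha>: "\<alpha> \<in> Field W" "\<alpha> \<noteq> ord_zero" "\<not> meager_in (tau \<alpha>) (B \<inter> A \<alpha>)"
    by blast
  obtain V where V: "openin (tau \<alpha>) V" "meager_in (tau \<alpha>) ((B \<inter> A \<alpha> - V) \<union> (V - B \<inter> A \<alpha>))"
    using Borel_Tr_baire_property[OF B(1)] unfolding baire_property_def by blast
  have "V \<noteq> {}" using V(2) \<alpha>(3) by auto
  then obtain T where "T \<in> V" by blast
  then obtain n where n: "U \<alpha> n T \<subseteq> V" using openin_tau_imp_U_subset[OF V(1)] by blast
  have "T \<in> A \<alpha>" using openin_subset[OF V(1)] \<open>T \<in> V\<close> topspace_tau by blast
  then have "U \<alpha> n T \<in> tau_base \<alpha>" unfolding tau_base_def by blast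
  moreover have "U \<alpha> n T - B \<subseteq> (B \<inter> A \<alpha> - V) \<union> (V - B \<inter> A \<alpha>)" using n U_subset_A by blast
  then have "meager_in (tau \<alpha>) (U \<alpha> n T - B)" by (rule meager_in_subset[OF V(2)])
  ultimately show ?thesis using \<alpha>(1,2) by blast
qed

lemma card_Sigma_tau_base: "|SIGMA \<alpha>:Field W. tau_base \<alpha>| \<le>o W"
proof (rule card_of_Sigma_ordLeq_infinite_Field[OF infinite_Field_W Card_order_W])
  show "|Field W| \<le>o W" by (rule ordIso_imp_ordLeq[OF card_of_Field_ordIso[OF Card_order_W]])
  have natLeq_W: "natLeq \<le>o W" by (rule ordLess_imp_ordLeq[OF cardSuc_greater[OF natLeq_Card_order]])
  show "\<forall>\<alpha>\<in>Field W. |tau_base \<alpha>| \<le>o W"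
  proof
    fix \<alpha>
    have "|tau_base \<alpha>| \<le>o natLeq"
      using countable_tau_base unfolding countable_card_le_natLeq .
    then show "|tau_base \<alpha>| \<le>o W" using ordLeq_transitive[OF _ natLeq_W] by blast
  qed
qed

lemma Istar_omega2_cc:
  assumes F: "\<forall>B\<in>F. Borel_Tr B \<and> B \<notin> Istar" "\<forall>B1\<in>F. \<forall>B2\<in>F. B1 \<noteq> B2 \<longrightarrow> B1 \<inter> B2 \<in> Istar"
  shows "\<not> cardSuc W \<le>o |F|"
proof
  assume F3: "cardSuc W \<le>o |F|"
  have "\<forall>B\<in>F. \<exists>c. c \<in> (SIGMA \<alpha>:Field W - {ord_zero}. tau_base \<alpha>) \<and> meager_in (tau (fst c)) (snd c - B)"
  proof
    fix B assume "B \<in> F"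
    then obtain \<alpha> V where "\<alpha> \<in> Field W - {ord_zero}" "V \<in> tau_base \<alpha>" "meager_in (tau \<alpha>) (V - B)"
      using F(1) Borel_notin_Istar_imp_comeager_in_base by blast
    then show "\<exists>c. c \<in> (SIGMA \<alpha>:Field W - {ord_zero}. tau_base \<alpha>) \<and> meager_in (tau (fst c)) (snd c - B)"
      by (intro exI[of _ "(\<alpha>, V)"]) simp
  qed
  then obtain c where c: "\<forall>B\<in>F. c B \<in> (SIGMA \<alpha>:Field W - {ord_zero}. tau_base \<alpha>) \<and>
      meager_in (tau (fst (c B))) (snd (c B) - B)"
    by (rule bchoice[THEN exE]) blast
  have "inj_on c F"
  proof (rule inj_onI, rule ccontr)
    fix B1 B2 assume B: "B1 \<in> F" "B2 \<in> F" "c B1 = c B2" "B1 \<noteq> B2"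
    obtain \<alpha> V where cB: "c B1 = (\<alpha>, V)" "c B2 = (\<alpha>, V)" using surj_pair B(3) by metis
    have "c B1 \<in> (SIGMA \<alpha>:Field W - {ord_zero}. tau_base \<alpha>)"
      and "meager_in (tau (fst (c B1))) (snd (c B1) - B1)"
      and "meager_in (tau (fst (c B2))) (snd (c B2) - B2)"
      using c B(1,2) by blast+
    then have \<alpha>: "\<alpha> \<in> Field W" "\<alpha> \<noteq> ord_zero" and "V \<in> tau_base \<alpha>"
      and meager: "meager_in (tau \<alpha>) (V - B1)" "meager_in (tau \<alpha>) (V - B2)"
      unfolding cB by simp_all
    then obtain n T where T: "T \<in> A \<alpha>" "V = U \<alpha> n T" unfolding tau_base_def by blast
    have "B1 \<inter> B2 \<in> Istar" using F(2) B by blast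
    then have "meager_in (tau \<alpha>) (B1 \<inter> B2 \<inter> A \<alpha>)" using Istar_imp_meager[OF _ \<alpha>] by blast
    then have "meager_in (tau \<alpha>) ((V - B1) \<union> (V - B2) \<union> (B1 \<inter> B2 \<inter> A \<alpha>))"
      using meager_in_Un meager by blast
    moreover have "V \<subseteq> (V - B1) \<union> (V - B2) \<union> (B1 \<inter> B2 \<inter> A \<alpha>)" using T U_subset_A by blast
    ultimately have "meager_in (tau \<alpha>) V" by (rule meager_in_subset)
    moreover have "openin (tau \<alpha>) V" using openin_tau_U[OF T(1)] T(2) by simp
    moreover have "V \<noteq> {}" using mem_U_self[OF T(1)] T(2) by blast
    ultimately show False using tau_Baire by blast
  qed
  moreover have "(SIGMA \<alpha>:Field W - {ord_zero}. tau_base \<alpha>) \<subseteq> (SIGMA \<alpha>:Field W. tau_base \<alpha>)" by blast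
  then have "c ` F \<subseteq> (SIGMA \<alpha>:Field W. tau_base \<alpha>)" using c by blast
  ultimately have "|F| \<le>o |SIGMA \<alpha>:Field W. tau_base \<alpha>|" by (intro card_of_ordLeqI) blast+
  then have "cardSuc W \<le>o W" using ordLeq_transitive[OF F3 ordLeq_transitive] card_Sigma_tau_base by blast
  then show False using not_ordLess_ordLeq[OF cardSuc_greater[OF Card_order_W]] by blast
qed

theorem proposition5p4:
  shows
    \<comment> \<open>sigma-ideal of subsets of Tr\<close>
    "(\<forall>S\<in>Istar. S \<subseteq> Tr)
   \<and> (\<forall>S S'. S \<in> Istar \<and> S' \<subseteq> S \<longrightarrow> S' \<in> Istar)
   \<and> (\<forall>F. countable F \<and> F \<subseteq> Istar \<longrightarrow> \<Union>F \<in> Istar)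
    \<comment> \<open>Borel: every member is covered by a Borel member\<close>
   \<and> (\<forall>S\<in>Istar. \<exists>B. Borel_Tr B \<and> S \<subseteq> B \<and> B \<in> Istar)
    \<comment> \<open>non-trivial\<close>
   \<and> Tr \<notin> Istar
    \<comment> \<open>not ccc\<close>
   \<and> (\<exists>F. (\<forall>B\<in>F. Borel_Tr B \<and> B \<notin> Istar)
          \<and> (\<forall>B1\<in>F. \<forall>B2\<in>F. B1 \<noteq> B2 \<longrightarrow> B1 \<inter> B2 = {})
          \<and> \<not> countable F)
    \<comment> \<open>omega_2-chain condition\<close>
   \<and> \<not> (\<exists>F. (\<forall>B\<in>F. Borel_Tr B \<and> B \<notin> Istar)
          \<and> (\<forall>B1\<in>F. \<forall>B2\<in>F. B1 \<noteq> B2 \<longrightarrow> B1 \<inter> B2 \<in> Istar)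
          \<and> (cardSuc (cardSuc natLeq), card_of F) \<in> ordLeq)"
proof (intro conjI)
  show "\<forall>S\<in>Istar. S \<subseteq> Tr" using Istar_subset_Tr by blast
  show "\<forall>S S'. S \<in> Istar \<and> S' \<subseteq> S \<longrightarrow> S' \<in> Istar" using Istar_subset by blast
  show "\<forall>F. countable F \<and> F \<subseteq> Istar \<longrightarrow> \<Union>F \<in> Istar" using Istar_countable_Union by blast
  show "\<forall>S\<in>Istar. \<exists>B. Borel_Tr B \<and> S \<subseteq> B \<and> B \<in> Istar" using Istar_Borel_hull by blast
  show "Tr \<notin> Istar" by (rule Tr_notin_Istar)
  show "\<exists>F. (\<forall>B\<in>F. Borel_Tr B \<and> B \<notin> Istar) \<and> (\<forall>B1\<in>F. \<forall>B2\<in>F. B1 \<noteq> B2 \<longrightarrow> B1 \<inter> B2 = {})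
      \<and> \<not> countable F"
    by (rule Istar_not_ccc)
  show "\<not> (\<exists>F. (\<forall>B\<in>F. Borel_Tr B \<and> B \<notin> Istar)
      \<and> (\<forall>B1\<in>F. \<forall>B2\<in>F. B1 \<noteq> B2 \<longrightarrow> B1 \<inter> B2 \<in> Istar)
      \<and> (cardSuc (cardSuc natLeq), card_of F) \<in> ordLeq)"
    using Istar_omega2_cc by blast
qed

end
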